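(* For every $\delta\in(0,\pi)$ there exists a non-circular magnetic billiard in the plane with the $\delta$-Gutkin property, i.e. a bounded domain $\Omega\subset\mathbb{R}^2$ whose boundary is a smooth simple closed curve that is not a circle, together with a magnitude $\beta>0$ of the magnetic field, such that the magnetic billiard in $\Omega$ has the $\delta$-Gutkin property.
   Context: Magnetic billiard in $\Omega$ with constant field of magnitude $\beta>0$: a particle moves inside $\Omega$ with unit speed along arcs of circles of radius $r=1/\beta$ traversed counterclockwise (Larmor arcs); on hitting $\gamma=\partial\Omega$ it is reflected by the law of geometric optics. The billiard has the $\delta$-Gutkin property ($0<\delta<\pi$) if every Larmor arc entering $\Omega$ making angle $\delta$ with $\gamma$ exits $\Omega$ making the same angle $\delta$ with $\gamma$. *)

theory Defs
  imports "HOL-Complex_Analysis.Complex_Analysis"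
begin

definition vd :: "(real \<Rightarrow> complex) \<Rightarrow> real \<Rightarrow> complex" where
  "vd f = (\<lambda>t. vector_derivative f (at t))"

definition smooth_curve :: "(real \<Rightarrow> complex) \<Rightarrow> bool" where
  "smooth_curve g \<longleftrightarrow> (\<forall>n t. ((vd ^^ n) g) differentiable (at t))"

definition smooth_pos_jordan_curve :: "(real \<Rightarrow> complex) \<Rightarrow> bool" where
  "smooth_pos_jordan_curve g \<longleftrightarrow>
     smooth_curve g \<and>
     (\<forall>t. g (t + 1) = g t) \<and>
     inj_on g {0..<1} \<and>
     (\<forall>t. vd g t \<noteq> 0) \<and>
     (\<forall>z\<in>inside (path_image g). winding_number g z = 1)"

definition unit_tangent :: "(real \<Rightarrow> complex) \<Rightarrow> real \<Rightarrow> complex" where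
  "unit_tangent g s = vd g s / complex_of_real (norm (vd g s))"

text \<open>Larmor arc of radius 1/beta, unit speed, traversed counterclockwise,
  starting at p with unit velocity v.  Its velocity at time t is v * cis (beta * t).\<close>
definition larmor :: "real \<Rightarrow> complex \<Rightarrow> complex \<Rightarrow> real \<Rightarrow> complex" where
  "larmor \<beta> p v t = p + (\<i> * v / complex_of_real \<beta>) * (1 - cis (\<beta> * t))"

text \<open>delta-Gutkin property of the magnetic billiard in the domain inside the curve g:
  the Larmor arc entering at g s with velocity making angle delta with the tangent
  (i.e. velocity cis delta * T) stays in the domain until it hits the boundary at some
  g s1, where its velocity again makes angle delta with the tangent (outgoing, i.e.
  velocity cis (-delta) * T(s1)).\<close>
definition magnetic_gutkin :: "real \<Rightarrow> real \<Rightarrow> (real \<Rightarrow> complex) \<Rightarrow> bool" where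
  "magnetic_gutkin \<delta> \<beta> g \<longleftrightarrow>
     (\<forall>s. \<exists>t1>0.
        (\<forall>t\<in>{0<..<t1}. larmor \<beta> (g s) (cis \<delta> * unit_tangent g s) t \<in> inside (path_image g)) \<and>
        (\<exists>s1. g s1 = larmor \<beta> (g s) (cis \<delta> * unit_tangent g s) t1 \<and>
              cis \<delta> * unit_tangent g s * cis (\<beta> * t1) = cis (- \<delta>) * unit_tangent g s1))"

end

theory Submission
  imports Defs
begin

text \<open>
  A Larmor arc that leaves the table \<open>\<gamma>\<close> at angle \<open>\<delta>\<close> has its centre on \<open>\<gamma> + \<i> r cis \<delta> T\<close>, and one that
  returns at angle \<open>\<delta>\<close> has it on \<open>\<gamma> + \<i> r cis (- \<delta>) T\<close>. The table has the Gutkin property when these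
  two curves are the same curve \<open>\<Gamma>\<close>. It suffices that \<open>\<Gamma>\<close> is traversed at constant speed, that its chords
  \<open>\<Gamma> (t + \<theta>) - \<Gamma> (t - \<theta>)\<close> have constant length, and that \<open>\<gamma>\<close> is parallel to the curve of their midpoints.

  Such curves \<open>\<Gamma>\<close> were found by Wegner. Here \<open>\<Gamma> t = cis t * \<theta> (h\<^sup>2 Z) / \<theta> Z\<close> with a theta function \<open>\<theta>\<close> of
  real nome and \<open>Z\<close> a multiple of \<open>cis (n t)\<close>. By Weierstrass' three-term relation there is a phase \<open>Y u\<close>
  for which \<open>\<bar>Y u * \<Gamma> t - cnj (Y u) * \<Gamma> (t + u)\<bar>\<close> does not depend on \<open>t\<close>. So the speed is constant if
  \<open>Y\<close> has derivative 0 at 0, and the chord is constant if \<open>Y u\<close> is real; the intermediate value theorem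
  provides first \<open>h\<close>, then \<open>u\<close>. When the nome is small, \<open>\<Gamma>\<close> is close to the unit circle, and
  the geometry of the arcs is that of the circular billiard. The table is not a circle because
  \<open>\<Gamma>\<close> continues to a meromorphic function whose poles are not invariant under the shift by \<open>u\<close>.
\<close>

section \<open>A theta function with real nome\<close>

text \<open>The nome has to be negative. Let \<open>a\<close> be the shift of the arguments in the
  three-term relation. The reflection that gives its right-hand side constant modulus relative to
  the denominators needs nome = a |Z|^2, whereas constant speed needs \<open>a\<close> close to (1 -
  n) / (1 + n). Hence a = -h with h near (n - 1) / (n + 1), and the nome is written -p^2. The angle
  \<delta> enters through n alone. The half-angle \<theta> = u / 2 of the chord lies between \<pi> /
  n and 3 \<pi> / (2 n), and a circular table with these data exists only if \<theta> + \<delta> <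
  \<pi>. So n has to grow as \<delta> approaches \<pi>. In the circular case the origin, a centre
  and a table point form a triangle with sides 1, r, R opposite to the angles \<delta>, \<theta>,
  \<pi> - \<theta> - \<delta>. The law of sines gives r = sin \<theta> / sin \<delta> and R = sin
  (\<theta> + \<delta>) / sin \<delta>. Neither h nor \<theta> is explicit, and both depend on p.
  The admissible perturbation \<epsilon> is therefore fixed before \<theta> is known, uniformly over
  the interval above, and p is chosen after \<epsilon>.\<close>

text \<open>Euler's expansion of the infinite product \<open>(1 - w) (1 - q w) (1 - q\<^sup>2 w) \<dots>\<close>; only the functional
  equation of the product is needed below.\<close>

primrec euler_coeff :: "real \<Rightarrow> nat \<Rightarrow> complex" where
  "euler_coeff q 0 = 1"
| "euler_coeff q (Suc k) = - of_real (q ^ k / (1 - q ^ Suc k)) * euler_coeff q k"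

definition qphi :: "real \<Rightarrow> complex \<Rightarrow> complex" where
  "qphi q w = (\<Sum>k. euler_coeff q k * w ^ k)"

definition qtheta :: "real \<Rightarrow> complex \<Rightarrow> complex" where
  "qtheta q w = qphi q w * qphi q (of_real q / w)"

context
  fixes q :: real
  assumes q0: "q \<noteq> 0" and q2: "\<bar>q\<bar> \<le> 1 / 2"
begin

lemma abs_pow_q_le: "\<bar>q ^ Suc k\<bar> \<le> 1 / 2"
proof -
  have "\<bar>q\<bar> ^ Suc k \<le> \<bar>q\<bar> ^ 1"
    by (rule power_decreasing) (use q2 in auto)
  then show ?thesis using q2 by (simp add: power_abs[symmetric] abs_mult)
qed

lemma one_minus_pow_q_ge: "1 - q ^ Suc k \<ge> 1 / 2"
  using abs_pow_q_le[of k] by linarith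

lemma euler_ratio_le: "\<bar>q ^ k / (1 - q ^ Suc k)\<bar> \<le> 2 * (1 / 2) ^ k"
proof -
  have "\<bar>q ^ k\<bar> \<le> (1 / 2) ^ k"
    unfolding power_abs by (rule power_mono) (use q2 in auto)
  moreover have "\<bar>1 - q ^ Suc k\<bar> \<ge> 1 / 2" using one_minus_pow_q_ge[of k] by linarith
  ultimately have "\<bar>q ^ k\<bar> / \<bar>1 - q ^ Suc k\<bar> \<le> (1 / 2) ^ k / (1 / 2)"
    by (intro frac_le) auto
  then show ?thesis by (simp add: abs_divide)
qed

lemma norm_euler_coeff_Suc:
  "norm (euler_coeff q (Suc k)) = \<bar>q ^ k / (1 - q ^ Suc k)\<bar> * norm (euler_coeff q k)"
  by (simp only: euler_coeff.simps norm_mult norm_minus_cancel norm_of_real)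

lemma norm_euler_coeff_le: "norm (euler_coeff q k) \<le> 2 ^ k"
proof (induction k)
  case (Suc k)
  have "\<bar>q ^ k / (1 - q ^ Suc k)\<bar> \<le> 2"
    by (rule order_trans[OF euler_ratio_le]) (simp add: power_le_one)
  then have "\<bar>q ^ k / (1 - q ^ Suc k)\<bar> * norm (euler_coeff q k) \<le> 2 * 2 ^ k"
    by (intro mult_mono Suc) auto
  then show ?case by (simp only: norm_euler_coeff_Suc power_Suc)
qed auto

text \<open>Consecutive terms have a ratio of order \<open>q ^ k * w\<close>, which tends to 0 for
  every \<open>w\<close>; so the series is entire.\<close>

lemma summable_euler: "summable (\<lambda>k. euler_coeff q k * w ^ k)"
proof -
  have lim: "(\<lambda>k. 2 * (1 / 2) ^ k * norm w) \<longlonglongrightarrow> 2 * 0 * norm w"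
    by (intro tendsto_intros LIMSEQ_power_zero) auto
  have "\<forall>\<^sub>F k in sequentially. 2 * (1 / 2) ^ k * norm w < 1 / 2"
    using order_tendstoD(2)[OF lim, of "1/2"] by simp
  then obtain N where N: "\<And>k. k \<ge> N \<Longrightarrow> 2 * (1 / 2) ^ k * norm w < 1 / 2"
    by (auto simp: eventually_sequentially)
  show ?thesis
  proof (rule summable_ratio_test[of "1/2" N])
    fix k assume k: "k \<ge> N"
    have "norm (euler_coeff q (Suc k) * w ^ Suc k)
        = (\<bar>q ^ k / (1 - q ^ Suc k)\<bar> * norm w) * norm (euler_coeff q k * w ^ k)"
      by (simp only: norm_mult norm_power norm_euler_coeff_Suc power_Suc mult_ac)
    also have "\<dots> \<le> 1 / 2 * norm (euler_coeff q k * w ^ k)"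
    proof (rule mult_right_mono)
      have "\<bar>q ^ k / (1 - q ^ Suc k)\<bar> * norm w \<le> 2 * (1 / 2) ^ k * norm w"
        by (rule mult_right_mono[OF euler_ratio_le]) auto
      then show "\<bar>q ^ k / (1 - q ^ Suc k)\<bar> * norm w \<le> 1 / 2" using N[OF k] by linarith
    qed auto
    finally show "norm (euler_coeff q (Suc k) * w ^ Suc k) \<le> 1 / 2 * norm (euler_coeff q k * w ^ k)" .
  qed auto
qed

lemma qphi_sums: "(\<lambda>k. euler_coeff q k * w ^ k) sums qphi q w"
  unfolding qphi_def by (rule summable_sums[OF summable_euler])

lemma qphi_0: "qphi q 0 = 1"
proof -
  have "(\<lambda>k. euler_coeff q k * 0 ^ k) sums euler_coeff q 0"
    by (rule powser_sums_zero)
  then show ?thesis using sums_unique2[OF qphi_sums[of 0]] by simp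
qed

lemma holomorphic_qphi_UNIV: "qphi q holomorphic_on UNIV"
proof -
  have "(\<lambda>w. \<Sum>k. euler_coeff q k * w ^ k) holomorphic_on UNIV"
    unfolding holomorphic_on_def field_differentiable_def
    using termdiffs_strong_converges_everywhere[OF summable_euler] by blast
  then show ?thesis by (simp add: qphi_def[abs_def])
qed

lemma holomorphic_qphi [holomorphic_intros]:
  "f holomorphic_on A \<Longrightarrow> (\<lambda>z. qphi q (f z)) holomorphic_on A"
  using holomorphic_on_compose_gen[OF _ holomorphic_qphi_UNIV, of f A] by (auto simp: o_def)

text \<open>Multiplied out, the recursion of the coefficients reads
  \<open>c (Suc k) = q ^ Suc k * c (Suc k) - q ^ k * c k\<close>, which is the functional equation
  coefficient by coefficient.\<close>

lemma qphi_step: "qphi q w = (1 - w) * qphi q (of_real q * w)"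
proof -
  let ?c = "euler_coeff q" and ?Q = "of_real q :: complex"
  have shift: "(\<lambda>k. ?c (Suc k) * w ^ Suc k) sums (qphi q w - 1)" for w
    using qphi_sums[of w] by (subst sums_Suc_iff) simp
  have coeff: "?c (Suc k) * w ^ Suc k = ?c (Suc k) * (?Q * w) ^ Suc k - w * (?c k * (?Q * w) ^ k)" for k
  proof -
    have ne: "1 - q ^ Suc k \<noteq> 0" using one_minus_pow_q_ge[of k] by linarith
    have "?c (Suc k) * of_real (1 - q ^ Suc k)
        = - (of_real (q ^ k / (1 - q ^ Suc k)) * of_real (1 - q ^ Suc k)) * ?c k"
      unfolding euler_coeff.simps by (simp only: mult_minus_left mult_minus_right mult_ac)
    also have "of_real (q ^ k / (1 - q ^ Suc k)) * of_real (1 - q ^ Suc k) = ?Q ^ k"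
      unfolding of_real_mult[symmetric] using ne by (simp del: power_Suc)
    finally have "?c (Suc k) = ?c (Suc k) * ?Q ^ Suc k - ?c k * ?Q ^ k"
      by (simp add: algebra_simps del: euler_coeff.simps power_Suc)
    then have "?c (Suc k) * w ^ Suc k = (?c (Suc k) * ?Q ^ Suc k - ?c k * ?Q ^ k) * w ^ Suc k"
      by (simp only:)
    then show ?thesis by (simp add: algebra_simps power_mult_distrib del: euler_coeff.simps)
  qed
  have "(\<lambda>k. ?c (Suc k) * (?Q * w) ^ Suc k - w * (?c k * (?Q * w) ^ k)) sums
          ((qphi q (?Q * w) - 1) - w * qphi q (?Q * w))"
    by (intro sums_diff shift sums_mult qphi_sums)
  then have "(\<lambda>k. ?c (Suc k) * w ^ Suc k) sums ((qphi q (?Q * w) - 1) - w * qphi q (?Q * w))"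
    by (simp only: coeff[symmetric])
  then have "qphi q w - 1 = (qphi q (?Q * w) - 1) - w * qphi q (?Q * w)"
    using shift[of w] sums_unique2 by blast
  then show ?thesis by (simp add: algebra_simps)
qed

lemma cnj_euler_coeff: "cnj (euler_coeff q k) = euler_coeff q k"
  by (induction k) auto

lemma cnj_qphi: "cnj (qphi q w) = qphi q (cnj w)"
proof -
  have "(\<lambda>k. cnj (euler_coeff q k * w ^ k)) sums cnj (qphi q w)"
    using qphi_sums[of w] by (simp only: sums_cnj)
  then show ?thesis
    using sums_unique2[OF _ qphi_sums[of "cnj w"]] by (simp add: cnj_euler_coeff)
qed

text \<open>The majorant is geometric with ratio \<open>2 * norm w\<close>, at most 1/2. The
  constants 12, 108 and 432 of the later estimates descend from the factor 4.\<close>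

lemma norm_qphi_minus_1_le:
  assumes "norm w \<le> 1 / 4"
  shows "norm (qphi q w - 1) \<le> 4 * norm w"
proof -
  have s: "(\<lambda>k. euler_coeff q (Suc k) * w ^ Suc k) sums (qphi q w - 1)"
    using qphi_sums[of w] by (subst sums_Suc_iff) simp
  have "(\<lambda>k. (2 * norm w) ^ k) sums (1 / (1 - 2 * norm w))"
    by (rule geometric_sums) (use assms in auto)
  then have g: "(\<lambda>k. (2 * norm w) * (2 * norm w) ^ k) sums ((2 * norm w) * (1 / (1 - 2 * norm w)))"
    by (rule sums_mult)
  have "norm (qphi q w - 1) \<le> (2 * norm w) * (1 / (1 - 2 * norm w))"
  proof (rule norm_sums_le[OF s g])
    fix k
    have "norm (euler_coeff q (Suc k) * w ^ Suc k) \<le> 2 ^ Suc k * norm w ^ Suc k"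
      unfolding norm_mult norm_power by (intro mult_right_mono norm_euler_coeff_le) auto
    then show "norm (euler_coeff q (Suc k) * w ^ Suc k) \<le> 2 * norm w * (2 * norm w) ^ k"
      by (simp add: power_mult_distrib mult_ac)
  qed
  also have "\<dots> \<le> (2 * norm w) * (1 / (1 / 2))"
    using assms by (intro mult_left_mono divide_left_mono) auto
  finally show ?thesis by simp
qed

lemma qphi_iterate: "qphi q w = (\<Prod>j<m. 1 - of_real q ^ j * w) * qphi q (of_real q ^ m * w)"
proof (induction m)
  case (Suc m)
  show ?case
    using qphi_step[of "of_real q ^ m * w"] Suc by (simp add: mult_ac)
qed auto

text \<open>If no factor vanished, the iterated equation would carry the zero at \<open>w\<close> to
  zeros at all \<open>q ^ m * w\<close>; these tend to 0, where the value is 1.\<close>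

lemma qphi_zeroD:
  assumes "qphi q w = 0"
  shows "\<exists>j. of_real q ^ j * w = 1"
proof (rule ccontr)
  assume "\<nexists>j. of_real q ^ j * w = 1"
  then have "(\<Prod>j<m. 1 - of_real q ^ j * w) \<noteq> 0" for m
    by (auto simp: prod_zero_iff)
  then have z: "qphi q (of_real q ^ m * w) = 0" for m
    using qphi_iterate[of w m] assms by auto
  have "(\<lambda>m. of_real q ^ m * w) \<longlonglongrightarrow> 0 * w"
    by (intro tendsto_intros LIMSEQ_power_zero) (use q2 in auto)
  moreover have "isCont (qphi q) 0"
    using holomorphic_qphi_UNIV holomorphic_on_imp_continuous_on
    by (metis UNIV_I continuous_on_eq_continuous_at open_UNIV)
  ultimately have "(\<lambda>m. qphi q (of_real q ^ m * w)) \<longlonglongrightarrow> qphi q 0"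
    by (intro isCont_tendsto_compose[of 0 "qphi q"]) simp_all
  then show False using z qphi_0 by (simp add: LIMSEQ_const_iff)
qed

lemma qphi_nonzero: "norm w < 1 \<Longrightarrow> qphi q w \<noteq> 0"
proof
  assume w: "norm w < 1" and "qphi q w = 0"
  then obtain j where "of_real q ^ j * w = 1" using qphi_zeroD by blast
  then have "\<bar>q\<bar> ^ j * norm w = 1" by (metis norm_mult norm_of_real norm_one norm_power)
  moreover have "\<bar>q\<bar> ^ j \<le> 1" using q2 by (intro power_le_one) auto
  ultimately show False using w by (metis mult_left_le_one_le norm_ge_zero not_le zero_le_power abs_ge_zero)
qed

lemma deriv_qphi_step:
  "deriv (qphi q) w = - qphi q (of_real q * w) + (1 - w) * of_real q * deriv (qphi q) (of_real q * w)"
proof -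
  have D: "(qphi q has_field_derivative deriv (qphi q) w) (at w)" for w
    by (rule holomorphic_derivI[OF holomorphic_qphi_UNIV]) auto
  have "((\<lambda>w. (1 - w) * qphi q (of_real q * w)) has_field_derivative
      - qphi q (of_real q * w) + (1 - w) * (deriv (qphi q) (of_real q * w) * of_real q)) (at w)"
    by (rule derivative_eq_intros DERIV_chain2[OF D] refl | simp)+
  moreover have "(\<lambda>w. (1 - w) * qphi q (of_real q * w)) = qphi q"
    by (rule ext) (rule qphi_step[symmetric])
  ultimately have "deriv (qphi q) w
      = - qphi q (of_real q * w) + (1 - w) * (deriv (qphi q) (of_real q * w) * of_real q)"
    using DERIV_unique[OF D[of w]] by simp
  then show ?thesis by (simp add: mult_ac)
qed

text \<open>Simplicity of the zeros comes from the differentiated functional equation. At w = 1 only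
  \<open>- qphi q q\<close> survives; at every further zero the derivative is a nonzero multiple of
  the derivative at the preceding one.\<close>

lemma deriv_qphi_nonzero:
  assumes "of_real q ^ j * w = 1"
  shows "deriv (qphi q) w \<noteq> 0"
  using assms
proof (induction j arbitrary: w)
  case 0
  then have "w = 1" by simp
  then show ?case using deriv_qphi_step[of 1] qphi_nonzero[of "of_real q"] q2 by simp
next
  case (Suc j)
  let ?Q = "of_real q :: complex"
  have w: "?Q ^ j * (?Q * w) = 1" using Suc.prems by (simp add: mult_ac)
  have "qphi q (?Q * w) = 0"
    using qphi_iterate[of "?Q * w" "Suc j"] w by simp
  moreover have "w \<noteq> 1"
  proof
    assume "w = 1"
    then have "\<bar>q\<bar> ^ Suc j = 1" using Suc.prems
      by (metis mult.right_neutral norm_of_real norm_one norm_power)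
    then show False using abs_pow_q_le[of j] unfolding power_abs by linarith
  qed
  ultimately show ?case
    using deriv_qphi_step[of w] Suc.IH[OF w] q0 by simp
qed

section \<open>Symmetries and zeros of the theta function\<close>

lemma holomorphic_qtheta: "qtheta q holomorphic_on - {0}"
  unfolding qtheta_def[abs_def] by (intro holomorphic_intros) auto

lemma holomorphic_qtheta_comp [holomorphic_intros]:
  "f holomorphic_on A \<Longrightarrow> (\<And>z. z \<in> A \<Longrightarrow> f z \<noteq> 0) \<Longrightarrow> (\<lambda>z. qtheta q (f z)) holomorphic_on A"
  using holomorphic_on_compose_gen[OF _ holomorphic_qtheta, of f A]
  by (simp add: o_def subset_Compl_singleton image_iff)

lemma qtheta_q_div: "w \<noteq> 0 \<Longrightarrow> qtheta q (of_real q / w) = qtheta q w"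
  using q0 by (simp add: qtheta_def)

lemma qtheta_q_mult:
  assumes "w \<noteq> 0"
  shows "qtheta q (of_real q * w) = - qtheta q w / w"
proof -
  have "qtheta q (of_real q * w) = qphi q (of_real q * w) * qphi q (1 / w)"
    using q0 by (simp add: qtheta_def)
  also have "qphi q (1 / w) = (1 - 1 / w) * qphi q (of_real q / w)"
    using qphi_step[of "1 / w"] by (simp only: times_divide_eq_right mult_1_right)
  also have "(1 - 1 / w) = - (1 - w) / w" using assms by (simp add: field_simps)
  finally show ?thesis
    unfolding qtheta_def qphi_step[of w] by (simp add: algebra_simps)
qed

lemma qtheta_inverse:
  assumes "w \<noteq> 0"
  shows "qtheta q (1 / w) = - qtheta q w / w"
  using qtheta_q_mult[OF assms] qtheta_q_div[of "of_real q * w"] assms q0 by simp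

lemma cnj_qtheta: "cnj (qtheta q w) = qtheta q (cnj w)"
  by (simp add: qtheta_def cnj_qphi)

lemma qtheta_1: "qtheta q 1 = 0"
  using qphi_step[of 1] by (simp add: qtheta_def)

lemma qtheta_zeroD:
  assumes "qtheta q w = 0" "w \<noteq> 0"
  shows "\<exists>k::int. w = of_real q powi k"
proof -
  let ?Q = "of_real q :: complex"
  have "qphi q w = 0 \<or> qphi q (?Q / w) = 0" using assms by (simp add: qtheta_def)
  then consider j where "?Q ^ j * w = 1" | j where "?Q ^ j * (?Q / w) = 1"
    using qphi_zeroD by metis
  then show ?thesis
  proof cases
    case 1
    then have "w = ?Q powi (- int j)" using q0
      by (simp add: power_int_minus field_simps)
    then show ?thesis by blast
  next
    case 2
    then have "w = ?Q ^ Suc j" using assms by (simp add: field_simps)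
    then have "w = ?Q powi (int (Suc j))" by (simp only: power_int_of_nat)
    then show ?thesis by blast
  qed
qed

text \<open>The zeros are integer powers of the real number \<open>q\<close>, so their moduli are
  pairwise different and no circle about 0 carries two of them.\<close>

lemma qtheta_zero_rotation:
  assumes "qtheta q w = 0" "qtheta q (\<sigma> * w) = 0" "norm \<sigma> = 1" "w \<noteq> 0"
  shows "\<sigma> = 1"
proof -
  let ?Q = "of_real q :: complex"
  obtain j k :: int where jk: "w = ?Q powi j" "\<sigma> * w = ?Q powi k"
    using qtheta_zeroD assms by (metis mult_eq_0_iff norm_zero zero_neq_one)
  have "\<bar>q\<bar> powi j = \<bar>q\<bar> powi k"
    using jk assms(3) by (metis mult_1 norm_mult norm_of_real norm_power_int)
  then have "j = k"
    using power_int_strict_decreasing[of j k "\<bar>q\<bar>"] power_int_strict_decreasing[of k j "\<bar>q\<bar>"] q0 q2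
    by (cases j k rule: linorder_cases) auto
  then have "\<sigma> * w = 1 * w" using jk by simp
  then show ?thesis using assms(4) using mult_right_cancel by blast
qed

lemma qtheta_nonzero:
  assumes "\<bar>q\<bar> < norm w" "norm w < 1 \<or> norm w < 1 / \<bar>q\<bar> \<and> norm w \<noteq> 1"
  shows "qtheta q w \<noteq> 0"
proof
  assume "qtheta q w = 0"
  moreover have "w \<noteq> 0" using assms by auto
  ultimately obtain k :: int where k: "w = of_real q powi k" using qtheta_zeroD by blast
  then have n: "norm w = \<bar>q\<bar> powi k" by (simp add: norm_power_int)
  have q: "0 < \<bar>q\<bar>" "\<bar>q\<bar> < 1" "\<bar>q\<bar> \<le> 1" using q0 q2 by auto
  consider "k = 0" | "k \<ge> 1" | "k \<le> -1" by linarith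
  then show False
  proof cases
    case 1
    then show False using n assms by auto
  next
    case 2
    then have "\<bar>q\<bar> powi k \<le> \<bar>q\<bar> powi 1" using q by (intro power_int_decreasing) auto
    then show False using n assms by simp
  next
    case 3
    then have "\<bar>q\<bar> powi (-1) \<le> \<bar>q\<bar> powi k" using q by (intro power_int_decreasing) auto
    then have "1 / \<bar>q\<bar> \<le> norm w" using n by (simp add: power_int_minus inverse_eq_divide)
    moreover have "1 / \<bar>q\<bar> > 1" using q by simp
    ultimately show False using assms(2) by linarith
  qed
qed

lemma deriv_qtheta_nonzero:
  assumes "qtheta q w = 0" "w \<noteq> 0"
  shows "deriv (qtheta q) w \<noteq> 0"
proof -
  let ?Q = "of_real q :: complex"
  have D: "(qphi q has_field_derivative deriv (qphi q) w) (at w)" for w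
    by (rule holomorphic_derivI[OF holomorphic_qphi_UNIV]) auto
  have "((\<lambda>w. qphi q w * qphi q (?Q / w)) has_field_derivative
      deriv (qphi q) w * qphi q (?Q / w) + qphi q w * (deriv (qphi q) (?Q / w) * (- ?Q / w\<^sup>2))) (at w)"
    using assms(2) by (auto intro!: derivative_eq_intros DERIV_chain2[OF D] simp: D power2_eq_square)
  then have d: "deriv (qtheta q) w =
      deriv (qphi q) w * qphi q (?Q / w) + qphi q w * (deriv (qphi q) (?Q / w) * (- ?Q / w\<^sup>2))"
    unfolding qtheta_def[abs_def] by (rule DERIV_imp_deriv)
  \<comment> \<open>The product of the two arguments is \<open>q\<close>, so one of them lies in the
    unit disc, where \<open>qphi\<close> has no zero. Hence exactly one factor of
    \<open>qtheta\<close> vanishes.\<close>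
  have one: "norm w < 1 \<or> norm (?Q / w) < 1"
    using q2 assms(2) by (auto simp: norm_divide divide_simps)
  have "qphi q w = 0 \<or> qphi q (?Q / w) = 0" using assms by (simp add: qtheta_def)
  then show ?thesis
  proof
    assume z: "qphi q w = 0"
    then have "deriv (qphi q) w \<noteq> 0" using qphi_zeroD deriv_qphi_nonzero by blast
    moreover have "qphi q (?Q / w) \<noteq> 0" using one z qphi_nonzero by blast
    ultimately show ?thesis using d z by simp
  next
    assume z: "qphi q (?Q / w) = 0"
    then have "deriv (qphi q) (?Q / w) \<noteq> 0" using qphi_zeroD deriv_qphi_nonzero by blast
    moreover have "qphi q w \<noteq> 0" using one z qphi_nonzero by blast
    ultimately show ?thesis using d z assms(2) q0 by simp
  qed
qed

end

section \<open>Quotients at simple zeros, and Liouville's theorem on the punctured plane\<close>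

lemma holomorphic_quotient_simple_zeros:
  assumes S: "open S" and f: "f holomorphic_on S" and h: "h holomorphic_on S"
    and zeros: "\<And>z. z \<in> S \<Longrightarrow> h z = 0 \<Longrightarrow> f z = 0 \<and> deriv h z \<noteq> 0"
  obtains k where "k holomorphic_on S" "\<And>z. z \<in> S \<Longrightarrow> f z = k z * h z"
proof
  \<comment> \<open>At a zero of \<open>h\<close> the value is the quotient of the derivatives,
    which is the limit of \<open>f / h\<close> there. So \<open>k\<close> is continuous and the
    isolated singularity is removable.\<close>
  define k where "k z = (if h z = 0 then deriv f z / deriv h z else f z / h z)" for z
  show "f z = k z * h z" if "z \<in> S" for z
    using zeros[OF that] by (simp add: k_def)
  have "k field_differentiable at z" if z: "z \<in> S" for z
  proof -
    have D: "(f has_field_derivative deriv f z) (at z)" "(h has_field_derivative deriv h z) (at z)"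
      using holomorphic_derivI[OF f S z] holomorphic_derivI[OF h S z] by auto
    have "\<forall>\<^sub>F w in at z. h w \<noteq> 0"
    proof (cases "h z = 0")
      case True
      have "\<forall>\<^sub>F w in at z. (h w - h z) / (w - z) \<noteq> 0"
        using D(2) zeros[OF z True] tendsto_imp_eventually_ne
        unfolding has_field_derivative_iff by blast
      then show ?thesis using True by (auto elim: eventually_mono)
    next
      case False
      have "(h \<longlongrightarrow> h z) (at z)" using D(2) by (meson DERIV_isCont isCont_def)
      then show ?thesis using False tendsto_imp_eventually_ne by blast
    qed
    moreover have "\<forall>\<^sub>F w in at z. w \<in> S"
      using S z by (metis eventually_at_in_open' )
    ultimately have "\<forall>\<^sub>F w in at z. h w \<noteq> 0 \<and> w \<in> S" by eventually_elim auto
    then obtain e where e: "e > 0" "\<And>w. w \<in> ball z e \<Longrightarrow> w \<noteq> z \<Longrightarrow> h w \<noteq> 0 \<and> w \<in> S"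
      by (auto simp: eventually_at dist_commute)
    have hol: "k holomorphic_on ball z e - {z}"
    proof -
      have "(\<lambda>w. f w / h w) holomorphic_on ball z e - {z}"
        by (intro holomorphic_intros holomorphic_on_subset[OF f] holomorphic_on_subset[OF h])
           (use e(2) in blast)+
      then show ?thesis
        by (rule holomorphic_transform) (use e in \<open>auto simp: k_def\<close>)
    qed
    have "(k \<longlongrightarrow> k z) (at z)"
    proof (cases "h z = 0")
      case True
      have "((\<lambda>w. ((f w - f z) / (w - z)) / ((h w - h z) / (w - z))) \<longlongrightarrow> deriv f z / deriv h z) (at z)"
        using D zeros[OF z True] unfolding has_field_derivative_iff
        by (intro tendsto_divide) auto
      moreover have "\<forall>\<^sub>F w in at z. ((f w - f z) / (w - z)) / ((h w - h z) / (w - z)) = k w"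
        unfolding eventually_at using e zeros[OF z True] True
        by (intro exI[of _ e]) (auto simp: k_def dist_commute)
      ultimately show ?thesis using True by (auto simp: k_def[of z] intro: Lim_transform_eventually)
    next
      case False
      have "((\<lambda>w. f w / h w) \<longlongrightarrow> f z / h z) (at z)"
        using D False by (intro tendsto_divide) (meson DERIV_isCont isCont_def)+
      moreover have "\<forall>\<^sub>F w in at z. f w / h w = k w"
        unfolding eventually_at using e by (intro exI[of _ e]) (auto simp: k_def dist_commute)
      ultimately show ?thesis using False by (auto simp: k_def[of z] intro: Lim_transform_eventually)
    qed
    then have "(k \<longlongrightarrow> k w) (at w within ball z e)" if "w \<in> {z}" for w
      using that tendsto_within_subset[of k _ z UNIV "ball z e"] by auto
    then have "k holomorphic_on ball z e"
      by (rule no_isolated_singularity'[OF _ hol]) auto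
    then show ?thesis
      using e(1) by (simp add: holomorphic_on_imp_differentiable_at)
  qed
  then show "k holomorphic_on S"
    by (simp add: S holomorphic_on_def field_differentiable_at_within)
qed

text \<open>Such a function lives on a torus: all its values are already taken on the compact
  annulus \<bar>q\<bar> \<le> \<bar>z\<bar> \<le> 1. Composition with \<open>exp\<close> then gives
  a bounded entire function.\<close>

lemma Liouville_multiplicative:
  fixes q :: real
  assumes q: "q \<noteq> 0" "\<bar>q\<bar> < 1" and F: "F holomorphic_on - {0}"
    and inv: "\<And>z. z \<noteq> 0 \<Longrightarrow> F (of_real q * z) = F z"
  obtains c where "\<And>z. z \<noteq> 0 \<Longrightarrow> F z = c"
proof -
  have powi: "F (of_real q powi k * z) = F z" if "z \<noteq> 0" for k z
  proof (induction k rule: int_induct[where k = 0])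
    case (step1 i)
    then show ?case
      using inv[of "of_real q powi i * z"] that q by (simp add: power_int_add mult_ac)
  next
    case (step2 i)
    then show ?case
      using inv[of "of_real q powi (i - 1) * z"] that q by (simp add: power_int_diff field_simps)
  qed auto
  have "compact (cball 0 1 - ball (0::complex) \<bar>q\<bar>)"
    by (intro compact_diff) auto
  moreover have "continuous_on (cball 0 1 - ball 0 \<bar>q\<bar>) F"
    by (rule continuous_on_subset[OF holomorphic_on_imp_continuous_on[OF F]]) (use q in auto)
  ultimately have bd: "bounded (F ` (cball 0 1 - ball 0 \<bar>q\<bar>))"
    using compact_continuous_image compact_imp_bounded by blast
  have red: "F z \<in> F ` (cball 0 1 - ball 0 \<bar>q\<bar>)" if z: "z \<noteq> 0" for z
  proof -
    let ?l = "log \<bar>q\<bar> (norm z)" and ?k = "\<lfloor>log \<bar>q\<bar> (norm z)\<rfloor>"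
    have "norm (of_real q powi (- ?k) * z) = \<bar>q\<bar> powr (- of_int ?k) * \<bar>q\<bar> powr ?l"
      using q z by (simp add: norm_mult norm_inverse norm_power_int powr_real_of_int' power_int_minus powr_minus)
    then have n: "norm (of_real q powi (- ?k) * z) = \<bar>q\<bar> powr (?l - of_int ?k)"
      by (simp flip: powr_add)
    have "0 \<le> ?l - of_int ?k" "?l - of_int ?k \<le> 1" by linarith+
    then have "\<bar>q\<bar> powr 1 \<le> \<bar>q\<bar> powr (?l - of_int ?k)" "\<bar>q\<bar> powr (?l - of_int ?k) \<le> \<bar>q\<bar> powr 0"
      using q by (intro powr_mono'; simp)+
    then have "of_real q powi (- ?k) * z \<in> cball 0 1 - ball 0 \<bar>q\<bar>"
      using n q by simp
    then show ?thesis using powi[OF z, of "- ?k"] by (metis imageI)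
  qed
  have "(\<lambda>w. F (exp w)) holomorphic_on UNIV"
  proof -
    have "exp ` UNIV \<subseteq> - {0 :: complex}" by auto
    from holomorphic_on_compose_gen[OF holomorphic_on_exp F this] show ?thesis by (simp add: o_def)
  qed
  moreover have "bounded (range (\<lambda>w. F (exp w)))"
    by (rule bounded_subset[OF bd]) (use red in auto)
  ultimately obtain c where c: "\<And>w. F (exp w) = c"
    using Liouville_theorem unfolding constant_on_def by blast
  show ?thesis
    by (rule that[of c]) (metis c exp_Ln)
qed

context
  fixes q :: real
  assumes q0: "q \<noteq> 0" and q2: "\<bar>q\<bar> \<le> 1 / 2"
begin

text \<open>Weierstrass' three-term relation, specialised to the arguments that occur here: both sides
  have the same multiplier under \<open>Z \<mapsto> q Z\<close>, and the left-hand side vanishes at the zeros of the right.\<close>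

lemma qtheta_three_term:
  assumes a: "a \<noteq> 0" and \<sigma>: "norm \<sigma> = 1" "\<sigma> \<noteq> 1"
  obtains C where "\<And>Z. Z \<noteq> 0 \<Longrightarrow>
    qtheta q (\<sigma> * a) * qtheta q (Z * a\<^sup>2) * qtheta q (\<sigma> * Z)
      + a * qtheta q (\<sigma> / a) * qtheta q (\<sigma> * Z * a\<^sup>2) * qtheta q Z
    = C * (qtheta q (Z * a) * qtheta q (\<sigma> * Z * a))"
proof -
  let ?\<theta> = "qtheta q" and ?Q = "of_real q :: complex"
  define N where "N Z = ?\<theta> (\<sigma> * a) * ?\<theta> (Z * a\<^sup>2) * ?\<theta> (\<sigma> * Z)
      + a * ?\<theta> (\<sigma> / a) * ?\<theta> (\<sigma> * Z * a\<^sup>2) * ?\<theta> Z" for Z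
  define M where "M Z = ?\<theta> (Z * a) * ?\<theta> (\<sigma> * Z * a)" for Z
  have \<sigma>0: "\<sigma> \<noteq> 0" using \<sigma> by auto
  note mult = qtheta_q_mult[OF q0 q2]
  have NQ: "N (?Q * Z) = N Z / (\<sigma> * Z\<^sup>2 * a\<^sup>2)" if "Z \<noteq> 0" for Z
  proof -
    have "N (?Q * Z) = ?\<theta> (\<sigma> * a) * ?\<theta> (?Q * (Z * a\<^sup>2)) * ?\<theta> (?Q * (\<sigma> * Z))
      + a * ?\<theta> (\<sigma> / a) * ?\<theta> (?Q * (\<sigma> * Z * a\<^sup>2)) * ?\<theta> (?Q * Z)"
      by (simp add: N_def mult_ac)
    also have "\<dots> = N Z / (\<sigma> * Z\<^sup>2 * a\<^sup>2)"
      using that a \<sigma>0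
      by (subst (1 2 3 4) mult) (auto simp: N_def field_simps power2_eq_square)
    finally show ?thesis .
  qed
  have MQ: "M (?Q * Z) = M Z / (\<sigma> * Z\<^sup>2 * a\<^sup>2)" if "Z \<noteq> 0" for Z
  proof -
    have "M (?Q * Z) = ?\<theta> (?Q * (Z * a)) * ?\<theta> (?Q * (\<sigma> * Z * a))"
      by (simp add: M_def mult_ac)
    also have "\<dots> = M Z / (\<sigma> * Z\<^sup>2 * a\<^sup>2)"
      using that a \<sigma>0 by (subst (1 2) mult) (auto simp: M_def field_simps power2_eq_square)
    finally show ?thesis .
  qed
  have Npow: "N (?Q powi k * Z) = 0" if "N Z = 0" "Z \<noteq> 0" for k Z
  proof (induction k rule: int_induct[where k = 0])
    case base
    then show ?case using that by simp
  next
    case (step1 i)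
    then show ?case
      using NQ[of "?Q powi i * Z"] that q0 by (simp add: power_int_add mult_ac)
  next
    case (step2 i)
    have eq: "?Q * (?Q powi (i - 1) * Z) = ?Q powi i * Z"
      using q0 by (simp add: power_int_diff)
    have "?Q powi (i - 1) * Z \<noteq> 0" using that(2) q0 by simp
    from NQ[OF this]
    have "N (?Q powi i * Z) = N (?Q powi (i - 1) * Z) / (\<sigma> * (?Q powi (i - 1) * Z)\<^sup>2 * a\<^sup>2)"
      unfolding eq .
    moreover have "\<sigma> * (?Q powi (i - 1) * Z)\<^sup>2 * a\<^sup>2 \<noteq> 0" using that(2) q0 a \<sigma>0 by simp
    ultimately show ?case using step2 by simp
  qed
  have inv: "?\<theta> (1 / w) = - ?\<theta> w / w" if "w \<noteq> 0" for w
    using qtheta_inverse[OF q0 q2 that] .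
  \<comment> \<open>Up to powers of \<open>q\<close> the zeros of \<open>M\<close> are 1 / a and 1 /
    (\<sigma> a). At each of them the two summands of \<open>N\<close> cancel by the inversion
    formula.\<close>
  have N1: "N (1 / a) = 0"
    using a inv[OF a] by (simp add: N_def power2_eq_square)
  have N2: "N (1 / (\<sigma> * a)) = 0"
  proof -
    have "?\<theta> (a / \<sigma>) = - ?\<theta> (\<sigma> / a) * a / \<sigma>" "?\<theta> (1 / (\<sigma> * a)) = - ?\<theta> (\<sigma> * a) / (\<sigma> * a)"
      using a \<sigma>0 inv[of "\<sigma> / a"] inv[of "\<sigma> * a"] by auto
    moreover have "1 / (\<sigma> * a) * a\<^sup>2 = a / \<sigma>" "\<sigma> * (1 / (\<sigma> * a)) = 1 / a"
        "\<sigma> * (1 / (\<sigma> * a)) * a\<^sup>2 = a"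
      using a \<sigma>0 by (auto simp: power2_eq_square)
    ultimately show ?thesis
      unfolding N_def inv[OF a] using a \<sigma>0 by (simp only: inv[OF a]) (simp add: field_simps)
  qed
  have D: "(?\<theta> has_field_derivative deriv ?\<theta> w) (at w)" if "w \<noteq> 0" for w
    using holomorphic_derivI[OF holomorphic_qtheta[OF q0 q2], of w] that by auto
  have dM: "deriv M Z = deriv ?\<theta> (Z * a) * a * ?\<theta> (\<sigma> * Z * a)
      + ?\<theta> (Z * a) * (deriv ?\<theta> (\<sigma> * Z * a) * (\<sigma> * a))" if "Z \<noteq> 0" for Z
    unfolding M_def[abs_def]
    by (rule DERIV_imp_deriv)
       (use that a \<sigma>0 in \<open>auto intro!: derivative_eq_intros DERIV_chain2[OF D] simp: field_simps\<close>)
  \<comment> \<open>As \<sigma> \<noteq> 1 has modulus 1, the two families of zeros of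
    \<open>M\<close> are disjoint. So exactly one term of the product rule survives, and it is
    nonzero because the zeros of \<open>qtheta\<close> are simple.\<close>
  have zeros: "N Z = 0 \<and> deriv M Z \<noteq> 0" if Z: "Z \<in> - {0}" and "M Z = 0" for Z
  proof -
    have Z0: "Z \<noteq> 0" "Z * a \<noteq> 0" "\<sigma> * Z * a \<noteq> 0" using Z a \<sigma>0 by auto
    from \<open>M Z = 0\<close> consider "?\<theta> (Z * a) = 0" | "?\<theta> (\<sigma> * Z * a) = 0" by (auto simp: M_def)
    then show ?thesis
    proof cases
      case 1
      then obtain k where "Z * a = ?Q powi k" using qtheta_zeroD[OF q0 q2] Z0 by blast
      then have "Z = ?Q powi k * (1 / a)" using a by (simp add: field_simps)
      then have "N Z = 0" using Npow[OF N1] a by simp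
      moreover have "?\<theta> (\<sigma> * Z * a) \<noteq> 0"
        using qtheta_zero_rotation[OF q0 q2 1, of \<sigma>] \<sigma> Z0 by (auto simp: mult.assoc)
      ultimately show ?thesis
        using 1 dM[OF Z0(1)] a deriv_qtheta_nonzero[OF q0 q2 1 Z0(2)] by simp
    next
      case 2
      then obtain k where "\<sigma> * Z * a = ?Q powi k" using qtheta_zeroD[OF q0 q2] Z0 by blast
      then have "Z = ?Q powi k * (1 / (\<sigma> * a))" using a \<sigma>0 by (simp add: field_simps)
      then have "N Z = 0" using Npow[OF N2] a \<sigma>0 by simp
      moreover have "?\<theta> (Z * a) \<noteq> 0"
        using qtheta_zero_rotation[OF q0 q2, of "Z * a" \<sigma>] 2 \<sigma> Z0 by (auto simp: mult.assoc)
      ultimately show ?thesis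
        using 2 dM[OF Z0(1)] a \<sigma>0 deriv_qtheta_nonzero[OF q0 q2 2 Z0(3)] by simp
    qed
  qed
  have holN: "N holomorphic_on - {0}" and holM: "M holomorphic_on - {0}"
    unfolding N_def[abs_def] M_def[abs_def]
    using a \<sigma>0 by (auto intro!: holomorphic_intros holomorphic_qtheta_comp[OF q0 q2])
  obtain K where K: "K holomorphic_on - {0}" "\<And>Z. Z \<in> - {0} \<Longrightarrow> N Z = K Z * M Z"
    using holomorphic_quotient_simple_zeros[OF _ holN holM zeros] by auto
  \<comment> \<open>The multipliers of \<open>N\<close> and \<open>M\<close> agree, but
    \<open>M\<close> can be cancelled only away from its zeros. These are simple, hence isolated,
    and continuity of \<open>K\<close> covers them.\<close>
  have KQ: "K (?Q * Z) = K Z" if Z: "Z \<noteq> 0" for Z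
  proof -
    let ?f = "\<lambda>w. K (?Q * w) - K w"
    have f0: "?f w = 0" if "w \<noteq> 0" "M w \<noteq> 0" for w
    proof -
      have "K (?Q * w) * M (?Q * w) = N (?Q * w)" using K(2)[of "?Q * w"] that q0 by simp
      then have "K (?Q * w) * M w = K w * M w"
        using NQ[OF that(1)] MQ[OF that(1)] K(2)[of w] that a \<sigma>0 by simp
      then show ?thesis using that by simp
    qed
    show ?thesis
    proof (cases "M Z = 0")
      case False
      then show ?thesis using f0[OF Z] by simp
    next
      case True
      have cont: "isCont ?f Z"
      proof -
        have "(\<lambda>w. ?Q * w) holomorphic_on - {0}" by (intro holomorphic_intros)
        moreover have "(\<lambda>w. ?Q * w) ` (- {0}) \<subseteq> - {0}" using q0 by auto
        ultimately have "(\<lambda>w. K (?Q * w)) holomorphic_on - {0}"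
          using holomorphic_on_compose_gen[OF _ K(1)] by (fastforce simp: o_def)
        then have "?f holomorphic_on - {0}" using K(1) by (rule holomorphic_on_diff)
        then show ?thesis
          using Z holomorphic_on_imp_continuous_on continuous_on_eq_continuous_at[of "- {0}"] by blast
      qed
      have "(M has_field_derivative deriv M Z) (at Z)"
        using holomorphic_derivI[OF holM, of Z] Z by auto
      then have "\<forall>\<^sub>F w in at Z. (M w - M Z) / (w - Z) \<noteq> 0"
        using zeros[of Z] True Z tendsto_imp_eventually_ne
        unfolding has_field_derivative_iff by blast
      moreover have "\<forall>\<^sub>F w in at Z. w \<noteq> 0"
        using Z by (intro eventually_at_in_open'[of "- {0}", simplified]) auto
      ultimately have "\<forall>\<^sub>F w in at Z. ?f w = 0"
        by eventually_elim (use True f0 in auto)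
      then have "(?f \<longlongrightarrow> 0) (at Z)" by (simp add: tendsto_eventually)
      then have "?f Z = 0" using cont unfolding isCont_def
        using LIM_unique by blast
      then show ?thesis by simp
    qed
  qed
  obtain C where C: "\<And>Z. Z \<noteq> 0 \<Longrightarrow> K Z = C"
    using Liouville_multiplicative[OF q0 _ K(1) KQ] q2 by auto
  show ?thesis
    by (rule that[of C]) (use K(2) C in \<open>simp add: N_def M_def\<close>)
qed

end

section \<open>Wegner curves\<close>

text \<open>For real \<open>t\<close> the values lie on the circle of radius p / sqrt h, which z
  \<mapsto> p^2 / (h cnj z) fixes pointwise. The radius lies strictly between p^2 and 1, which keeps
  the denominator of \<open>wegner\<close> nonzero. Being of order p, it makes both z and p^2 / z
  small, so that theta is close to 1.\<close>

definition wegner_arg :: "nat \<Rightarrow> real \<Rightarrow> real \<Rightarrow> complex \<Rightarrow> complex" where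
  "wegner_arg n p h t = - of_real (p / sqrt h) * exp (\<i> * of_nat n * t)"

definition wegner :: "nat \<Rightarrow> real \<Rightarrow> real \<Rightarrow> complex \<Rightarrow> complex" where
  "wegner n p h t = exp (\<i> * t) *
     (qtheta (- p\<^sup>2) (wegner_arg n p h t * of_real h ^ 2) / qtheta (- p\<^sup>2) (wegner_arg n p h t))"

text \<open>The exponential factor symmetrises the chord identity. The three-term relation yields
  coefficients W and \<sigma> cnj W with \<sigma> = exp (i n u), and the rotation in
  \<open>wegner\<close> contributes exp (i u); the exponent (1 - n) / 2 turns the two coefficients
  into complex conjugates.\<close>

definition wegner_phase :: "nat \<Rightarrow> real \<Rightarrow> real \<Rightarrow> real \<Rightarrow> complex" where
  "wegner_phase n p h u = exp (\<i> * of_real ((1 - real n) * u / 2)) *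
     qtheta (- p\<^sup>2) (- exp (\<i> * of_real (real n * u)) * of_real h)"

text \<open>Up to the factor \<open>\<i> n\<close> this is the derivative of the phase at 0.\<close>

definition wegner_defect :: "nat \<Rightarrow> real \<Rightarrow> real \<Rightarrow> complex" where
  "wegner_defect n p h = of_real ((1 / real n - 1) / 2) * qtheta (- p\<^sup>2) (- of_real h)
     - of_real h * deriv (qtheta (- p\<^sup>2)) (- of_real h)"

definition wegner_domain :: "nat \<Rightarrow> real \<Rightarrow> real \<Rightarrow> complex set" where
  "wegner_domain n p h = {t. qtheta (- p\<^sup>2) (wegner_arg n p h t) \<noteq> 0}"

lemma norm_quotient_tendsto:
  fixes f :: "real \<Rightarrow> 'a :: real_normed_vector"
  assumes f: "(f has_vector_derivative D) (at 0)" and f0: "f 0 = 0"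
  shows "((\<lambda>u. norm (f u) / \<bar>u\<bar>) \<longlongrightarrow> norm D) (at 0)"
proof -
  have lim: "((\<lambda>u. norm (f u - u *\<^sub>R D) / \<bar>u\<bar>) \<longlongrightarrow> 0) (at 0)"
    using f f0 by (simp add: has_vector_derivative_def has_derivative_at)
  have "((\<lambda>u. norm (f u) / \<bar>u\<bar> - norm D) \<longlongrightarrow> 0) (at 0)"
  proof (rule Lim_null_comparison[OF _ lim])
    have "norm (norm (f u) / \<bar>u\<bar> - norm D) \<le> norm (f u - u *\<^sub>R D) / \<bar>u\<bar>" if "u \<noteq> 0" for u
    proof -
      have "norm (f u) / \<bar>u\<bar> - norm D = (norm (f u) - norm (u *\<^sub>R D)) / \<bar>u\<bar>"
        using that by (simp add: diff_divide_distrib)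
      then show ?thesis
        using norm_triangle_ineq3[of "f u" "u *\<^sub>R D"] by (simp add: divide_right_mono)
    qed
    then show "\<forall>\<^sub>F u in at 0. norm (norm (f u) / \<bar>u\<bar> - norm D) \<le> norm (f u - u *\<^sub>R D) / \<bar>u\<bar>"
      by (auto simp: eventually_at intro!: exI[of _ 1])
  qed
  then show ?thesis by (rule LIM_zero_cancel)
qed

section \<open>Constant chords, constant speed and poles of the Wegner curve\<close>

locale wegner_curve =
  fixes n :: nat and p h :: real
  assumes n: "n \<ge> 1" and p: "0 < p" "p < 1 / 2" and h: "1 / 2 \<le> h" "h < 1"
begin

abbreviation "\<theta> \<equiv> qtheta (- p\<^sup>2)"
abbreviation "Z \<equiv> wegner_arg n p h"
abbreviation "\<Gamma> \<equiv> wegner n p h"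
abbreviation "Y \<equiv> wegner_phase n p h"

lemma nome: "- p\<^sup>2 \<noteq> 0" "\<bar>- p\<^sup>2\<bar> \<le> 1 / 2" "p\<^sup>2 < p" "p\<^sup>2 < 1 / 4"
proof -
  have "p * p < p * (1 / 2)" using p by (intro mult_strict_left_mono) auto
  then have "p\<^sup>2 < p / 2" by (simp add: power2_eq_square)
  then have "p\<^sup>2 < p" "p\<^sup>2 < 1 / 4" using p by linarith+
  then show "\<bar>- p\<^sup>2\<bar> \<le> 1 / 2" "p\<^sup>2 < p" "p\<^sup>2 < 1 / 4" by simp_all
  show "- p\<^sup>2 \<noteq> 0" using p by simp
qed

lemma sqrt_h: "0 < sqrt h" "sqrt h < 1" "1 / 2 < sqrt h"
  using h real_less_rsqrt[of "1/2" h] by (auto simp: power2_eq_square)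

lemma wegner_arg_nonzero: "Z t \<noteq> 0"
  using p h by (simp add: wegner_arg_def)

lemma norm_wegner_arg: "norm (Z t) = p / sqrt h * exp (- (real n * Im t))"
  using p h by (simp add: wegner_arg_def norm_mult norm_divide)

lemma wegner_arg_add: "Z (t + u) = exp (\<i> * of_nat n * u) * Z t"
  by (simp add: wegner_arg_def exp_add algebra_simps)

lemma wegner_arg_pi: "Z (t + 2 * of_real pi) = Z t"
proof -
  have "exp (\<i> * of_nat n * (2 * of_real pi)) = exp (2 * of_real pi * \<i>) ^ n"
    by (simp add: exp_of_nat_mult[symmetric] mult_ac)
  also have "\<dots> = 1" by simp
  finally show ?thesis by (simp add: wegner_arg_add)
qed

lemma qtheta_wegner_arg_nonzero: "\<theta> (Z (of_real t)) \<noteq> 0"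
proof (rule qtheta_nonzero[OF nome(1,2)])
  have "norm (Z (of_real t)) = p / sqrt h" by (simp add: norm_wegner_arg)
  moreover have "p < p / sqrt h" using p sqrt_h by (simp add: field_simps)
  moreover have "p / sqrt h < 1" using p sqrt_h by (simp add: field_simps)
  ultimately show "\<bar>- p\<^sup>2\<bar> < norm (Z (of_real t))"
    "norm (Z (of_real t)) < 1 \<or> norm (Z (of_real t)) < 1 / \<bar>- p\<^sup>2\<bar> \<and> norm (Z (of_real t)) \<noteq> 1"
    using nome by auto
qed

lemma holomorphic_wegner_arg: "Z holomorphic_on A"
  unfolding wegner_arg_def[abs_def] by (intro holomorphic_intros)

lemma holomorphic_theta_arg: "(\<lambda>t. \<theta> (c * Z t)) holomorphic_on A" if "c \<noteq> 0" for c
  by (intro holomorphic_qtheta_comp[OF nome(1,2)] holomorphic_intros holomorphic_wegner_arg)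
     (use that wegner_arg_nonzero in auto)

lemma open_wegner_domain: "open (wegner_domain n p h)"
proof -
  have "continuous_on UNIV (\<lambda>t. \<theta> (Z t))"
    using holomorphic_theta_arg[of 1 UNIV] holomorphic_on_imp_continuous_on by fastforce
  then have "open ((\<lambda>t. \<theta> (Z t)) -` (- {0}))" by (intro open_vimage) auto
  then show ?thesis by (simp add: wegner_domain_def vimage_def)
qed

lemma of_real_wegner_domain: "of_real t \<in> wegner_domain n p h"
  using qtheta_wegner_arg_nonzero by (simp add: wegner_domain_def)

lemma holomorphic_wegner: "\<Gamma> holomorphic_on wegner_domain n p h"
proof -
  have 1: "(\<lambda>t. \<theta> (Z t)) holomorphic_on A" "(\<lambda>t. \<theta> (Z t * of_real h ^ 2)) holomorphic_on A" for A
    using holomorphic_theta_arg[of 1 A] holomorphic_theta_arg[of "of_real h ^ 2" A] h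
    by (simp_all add: mult.commute)
  have "(\<lambda>t. exp (\<i> * t)) holomorphic_on A" for A by (intro holomorphic_intros)
  then show ?thesis
    unfolding wegner_def[abs_def]
    by (intro holomorphic_on_mult holomorphic_on_divide 1) (auto simp: wegner_domain_def)
qed

lemma wegner_periodic: "\<Gamma> (t + 2 * of_real pi) = \<Gamma> t"
proof -
  have "exp (\<i> * (t + 2 * of_real pi)) = exp (\<i> * t)"
  proof -
    have "\<i> * (t + 2 * of_real pi) = \<i> * t + 2 * of_real pi * \<i>" by (simp add: algebra_simps)
    then show ?thesis by (simp add: exp_add)
  qed
  then show ?thesis by (simp add: wegner_def wegner_arg_pi)
qed

text \<open>For real \<open>t\<close>, \<open>cnj (Z t)\<close> is the nome divided by -h Z t. The
  symmetry of theta under w \<mapsto> nome / w and its real coefficients do the rest. This is where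
  the sign of the nome and the radius of \<open>Z\<close> are used.\<close>

lemma norm_theta_arg_reflect: "norm (\<theta> (- Z (of_real t) * of_real h)) = norm (\<theta> (Z (of_real t)))"
proof -
  let ?z = "Z (of_real t)"
  have nz: "?z * cnj ?z = of_real (p\<^sup>2 / h)"
    using h by (simp add: complex_norm_square[symmetric] norm_wegner_arg power_divide)
  have "cnj ?z = of_real (- p\<^sup>2) / (- ?z * of_real h)"
    using nz h wegner_arg_nonzero[of "of_real t"] by (simp add: field_simps)
  then have "\<theta> (cnj ?z) = \<theta> (- ?z * of_real h)"
    using qtheta_q_div[OF nome(1,2), of "- ?z * of_real h"] wegner_arg_nonzero[of "of_real t"] h by simp
  then show ?thesis
    using cnj_qtheta[OF nome(1,2), of ?z] by (metis complex_mod_cnj)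
qed

text \<open>The three-term relation with a = -h is divided by
  \<open>\<theta> z * \<theta> (\<sigma> * z)\<close>. By the reflection the right-hand side then
  has modulus \<bar>C\<bar>, whatever \<open>t\<close> is.\<close>

lemma wegner_chord_identity:
  assumes "exp (\<i> * of_real (real n * u)) \<noteq> 1"
  obtains K where
    "\<And>t. norm (Y u * \<Gamma> (of_real t) - cnj (Y u) * \<Gamma> (of_real (t + u))) = K"
proof -
  define \<sigma> :: complex where "\<sigma> = exp (\<i> * of_real (real n * u))"
  define \<omega> where "\<omega> = exp (\<i> * of_real ((1 - real n) * u / 2))"
  define W where "W = \<theta> (- \<sigma> * of_real h)"
  let ?h = "of_real h :: complex"
  have n\<sigma>: "norm \<sigma> = 1" and \<sigma>0: "\<sigma> \<noteq> 0" by (simp_all add: \<sigma>_def)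
  have h0: "?h \<noteq> 0" using h by simp
  obtain C where C: "\<And>Z. Z \<noteq> 0 \<Longrightarrow>
      \<theta> (\<sigma> * - ?h) * \<theta> (Z * (- ?h)\<^sup>2) * \<theta> (\<sigma> * Z)
      + (- ?h) * \<theta> (\<sigma> / - ?h) * \<theta> (\<sigma> * Z * (- ?h)\<^sup>2) * \<theta> Z
    = C * (\<theta> (Z * - ?h) * \<theta> (\<sigma> * Z * - ?h))"
    using qtheta_three_term[OF nome(1,2), of "- ?h" \<sigma>] n\<sigma> assms h0 unfolding \<sigma>_def by auto
  have cW: "?h * \<theta> (- \<sigma> / ?h) = \<sigma> * cnj W"
  proof -
    \<comment> \<open>Conjugating W inverts its argument up to a factor, so the inversion formula
      relates the second coefficient of the relation to the conjugate of the first.\<close>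
    have "cnj \<sigma> = 1 / \<sigma>" using n\<sigma>
      by (metis complex_norm_square divide_inverse_commute inverse_unique mult.right_neutral of_real_1 one_power2)
    then have "cnj W = \<theta> (1 / (- \<sigma> / ?h))"
      by (simp add: W_def cnj_qtheta[OF nome(1,2)])
    also have "\<dots> = - \<theta> (- \<sigma> / ?h) / (- \<sigma> / ?h)"
      using \<sigma>0 h0 by (intro qtheta_inverse[OF nome(1,2)]) auto
    finally show ?thesis using \<sigma>0 h0 by (simp add: field_simps)
  qed
  have "norm (Y u * \<Gamma> (of_real t) - cnj (Y u) * \<Gamma> (of_real (t + u))) = norm C" for t
  proof -
    define z where "z = Z (of_real t)"
    have z0: "z \<noteq> 0" using wegner_arg_nonzero by (simp add: z_def)
    have z': "Z (of_real (t + u)) = \<sigma> * z"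
      using wegner_arg_add[of "of_real t" "of_real u"] by (simp add: z_def \<sigma>_def mult_ac)
    have nz: "\<theta> z \<noteq> 0" "\<theta> (\<sigma> * z) \<noteq> 0"
      using qtheta_wegner_arg_nonzero[of t] qtheta_wegner_arg_nonzero[of "t + u"] z' by (auto simp: z_def)
    have refl: "norm (\<theta> (- (z * ?h))) = norm (\<theta> z)"
        "norm (\<theta> (- (\<sigma> * z * ?h))) = norm (\<theta> (\<sigma> * z))"
      using norm_theta_arg_reflect[of t] norm_theta_arg_reflect[of "t + u"] z' by (auto simp: z_def)
    have "W * \<theta> (z * ?h\<^sup>2) * \<theta> (\<sigma> * z) - \<sigma> * cnj W * \<theta> (\<sigma> * z * ?h\<^sup>2) * \<theta> z
        = C * (\<theta> (z * - ?h) * \<theta> (\<sigma> * z * - ?h))"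
    proof -
      have "- ?h * \<theta> (\<sigma> / - ?h) = - (\<sigma> * cnj W)" "\<theta> (\<sigma> * - ?h) = W"
        using cW by (simp_all add: W_def)
      then show ?thesis using C[OF z0] by simp
    qed
    moreover have "W * (\<theta> (z * ?h\<^sup>2) / \<theta> z) - \<sigma> * cnj W * (\<theta> (\<sigma> * z * ?h\<^sup>2) / \<theta> (\<sigma> * z))
        = (W * \<theta> (z * ?h\<^sup>2) * \<theta> (\<sigma> * z) - \<sigma> * cnj W * \<theta> (\<sigma> * z * ?h\<^sup>2) * \<theta> z) / (\<theta> z * \<theta> (\<sigma> * z))"
      using nz by (simp add: field_simps)
    ultimately have key: "norm (W * (\<theta> (z * ?h\<^sup>2) / \<theta> z) - \<sigma> * cnj W * (\<theta> (\<sigma> * z * ?h\<^sup>2) / \<theta> (\<sigma> * z))) = norm C"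
      using nz by (simp add: norm_mult norm_divide refl)
    have "cnj \<omega> * exp (\<i> * of_real u) = \<omega> * \<sigma>"
      unfolding \<omega>_def \<sigma>_def by (simp add: exp_cnj field_simps flip: exp_add)
    then have \<omega>: "exp (\<i> * of_real (t + u)) * cnj \<omega> = exp (\<i> * of_real t) * \<omega> * \<sigma>"
      by (simp add: distrib_left exp_add mult_ac)
    have "Y u * \<Gamma> (of_real t) - cnj (Y u) * \<Gamma> (of_real (t + u))
        = exp (\<i> * of_real t) * \<omega> * W * (\<theta> (z * ?h\<^sup>2) / \<theta> z)
          - exp (\<i> * of_real (t + u)) * cnj \<omega> * (cnj W * (\<theta> (\<sigma> * z * ?h\<^sup>2) / \<theta> (\<sigma> * z)))"
      unfolding wegner_def wegner_phase_def z' z_def[symmetric] \<omega>_def[symmetric] \<sigma>_def[symmetric]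
        W_def[symmetric] by (simp only: complex_cnj_mult mult_ac)
    also have "\<dots> = exp (\<i> * of_real t) * \<omega> * (W * (\<theta> (z * ?h\<^sup>2) / \<theta> z)
          - \<sigma> * cnj W * (\<theta> (\<sigma> * z * ?h\<^sup>2) / \<theta> (\<sigma> * z)))"
      unfolding \<omega> by (simp add: algebra_simps)
    finally show ?thesis using key by (simp add: norm_mult \<omega>_def)
  qed
  then show ?thesis by (rule that)
qed

lemma wegner_chord_constant:
  assumes "exp (\<i> * of_real (real n * u)) \<noteq> 1" "Im (Y u) = 0"
  obtains c where "\<And>t. norm (\<Gamma> (of_real (t + u)) - \<Gamma> (of_real t)) = c"
proof -
  obtain K where K: "\<And>t. norm (Y u * \<Gamma> (of_real t) - cnj (Y u) * \<Gamma> (of_real (t + u))) = K"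
    using wegner_chord_identity[OF assms(1)] by blast
  let ?w = "- exp (\<i> * of_real (real n * u)) * of_real h"
  have nw: "norm ?w = h" using h by (simp add: norm_mult)
  have "\<theta> ?w \<noteq> 0"
    by (rule qtheta_nonzero[OF nome(1,2)]) (use nw h nome in auto)
  then have Y0: "Y u \<noteq> 0" by (simp add: wegner_phase_def)
  have "cnj (Y u) = Y u" using assms(2) by (simp add: complex_eq_iff)
  then have "norm (Y u) * norm (\<Gamma> (of_real (t + u)) - \<Gamma> (of_real t)) = K" for t
    using K[of t] by (simp add: right_diff_distrib[symmetric] norm_mult norm_minus_commute)
  then show ?thesis using Y0 that[of "K / norm (Y u)"] by (simp add: field_simps)
qed

lemma wegner_has_derivative:
  "(\<Gamma> has_field_derivative deriv \<Gamma> (of_real t)) (at (of_real t))"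
  by (rule holomorphic_derivI[OF holomorphic_wegner open_wegner_domain of_real_wegner_domain])

lemma wegner_phase_deriv_0:
  "(Y has_vector_derivative \<i> * of_nat n * wegner_defect n p h) (at 0)"
proof -
  have D: "(\<theta> has_field_derivative deriv \<theta> w) (at w)" if "w \<noteq> 0" for w
    using holomorphic_derivI[OF holomorphic_qtheta[OF nome(1,2)], of w] that by auto
  let ?Y = "\<lambda>u. exp (\<i> * ((1 - of_nat n) * u / 2)) * \<theta> (- exp (\<i> * (of_nat n * u)) * of_real h)"
  have "(?Y has_field_derivative \<i> * of_nat n * wegner_defect n p h) (at (of_real 0))"
    unfolding wegner_defect_def using h n
    by (auto intro!: derivative_eq_intros DERIV_chain2[OF D] simp: field_simps)
  then have "((\<lambda>u. ?Y (of_real u)) has_vector_derivative \<i> * of_nat n * wegner_defect n p h) (at 0)"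
    by (rule has_vector_derivative_real_field)
  moreover have "?Y (of_real u) = Y u" for u
    by (simp add: wegner_phase_def)
  ultimately show ?thesis by simp
qed

text \<open>The chord identity is differentiated at u = 0. Since \<open>Y 0\<close> is real,
  \<open>?F t\<close> vanishes there; since \<open>Y\<close> has derivative 0, the derivative of
  \<open>?F t\<close> is \<open>- Y 0 * deriv \<Gamma> t\<close>. Its modulus is the limit of
  \<open>norm (?F t u) / \<bar>u\<bar>\<close>, which does not depend on \<open>t\<close>.\<close>

lemma wegner_speed_constant:
  assumes "wegner_defect n p h = 0"
  shows "norm (deriv \<Gamma> (of_real t)) = norm (deriv \<Gamma> 0)"
proof -
  have Y0: "cnj (Y 0) = Y 0" "Y 0 \<noteq> 0"
  proof -
    show "cnj (Y 0) = Y 0" using cnj_qtheta[OF nome(1,2)] by (simp add: wegner_phase_def)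
    have "\<theta> (- of_real h) \<noteq> 0"
      by (rule qtheta_nonzero[OF nome(1,2)]) (use h nome in auto)
    then show "Y 0 \<noteq> 0" by (simp add: wegner_phase_def)
  qed
  let ?F = "\<lambda>t u. Y u * \<Gamma> (of_real t) - cnj (Y u) * \<Gamma> (of_real (t + u))"
  have lim: "((\<lambda>u. norm (?F t u) / \<bar>u\<bar>) \<longlongrightarrow> norm (Y 0) * norm (deriv \<Gamma> (of_real t))) (at 0)" for t
  proof -
    have YD: "(Y has_vector_derivative 0) (at 0)"
      using wegner_phase_deriv_0 assms by simp
    have "((\<lambda>u. \<Gamma> (of_real t + of_real u)) has_vector_derivative deriv \<Gamma> (of_real t)) (at 0)"
    proof -
      have "((\<lambda>w. \<Gamma> (of_real t + w)) has_field_derivative deriv \<Gamma> (of_real t)) (at (of_real 0))"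
        using wegner_has_derivative[of t] DERIV_shift[of \<Gamma> _ "of_real 0" "of_real t"]
        by (simp add: add.commute)
      then show ?thesis by (rule has_vector_derivative_real_field)
    qed
    then have "(?F t has_vector_derivative - Y 0 * deriv \<Gamma> (of_real t)) (at 0)"
      using YD Y0 by (auto intro!: derivative_eq_intros has_vector_derivative_cnj)
    from norm_quotient_tendsto[OF this] show ?thesis using Y0 by (simp add: norm_mult)
  qed
  have "\<forall>\<^sub>F u in at (0::real). norm (?F t u) / \<bar>u\<bar> = norm (?F 0 u) / \<bar>u\<bar>"
    unfolding eventually_at
  \<comment> \<open>For 0 < \<bar>u\<bar> < \<pi> / n the number n u is no multiple of 2 \<pi>, so
    the chord identity applies.\<close>
  proof (intro exI[of _ "pi / n"] conjI ballI impI)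
    show "pi / n > 0" using n by simp
    fix u :: real assume u: "u \<noteq> 0 \<and> dist u 0 < pi / real n"
    have "exp (\<i> * of_real (real n * u)) \<noteq> 1"
    proof
      assume "exp (\<i> * of_real (real n * u)) = 1"
      then have "cos (real n * u) = 1" by (simp only: cis_conv_exp[symmetric]) (simp add: complex_eq_iff)
      then obtain k :: int where k: "real n * u = k * 2 * pi" using cos_one_2pi_int by auto
      have "\<bar>real n * u\<bar> < pi" using u n by (simp add: abs_mult field_simps)
      then have "\<bar>of_int k :: real\<bar> < 1" using k by (simp add: abs_mult)
      then have "k = 0" by linarith
      then show False using k u n by simp
    qed
    then obtain K where "\<And>t. norm (?F t u) = K"
      using wegner_chord_identity[of u] by blast
    then show "norm (?F t u) / \<bar>u\<bar> = norm (?F 0 u) / \<bar>u\<bar>" by (simp only:)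
  qed
  then have "((\<lambda>u. norm (?F t u) / \<bar>u\<bar>) \<longlongrightarrow> norm (Y 0) * norm (deriv \<Gamma> (of_real 0))) (at 0)"
    by (intro Lim_transform_eventually[OF lim[of 0]]) (simp only: eq_commute)
  then have "norm (Y 0) * norm (deriv \<Gamma> (of_real t)) = norm (Y 0) * norm (deriv \<Gamma> (of_real 0))"
    by (rule LIM_unique[OF lim[of t]])
  then show ?thesis using Y0 by simp
qed

text \<open>Clearing denominators gives an entire function that vanishes on the real line, hence
  everywhere. At a pole of \<Gamma> with Z t = 1 every term containing \<open>\<theta> (Z t)\<close>
  drops out. What remains is b times nonzero factors: s \<noteq> 1 has modulus 1, and p^2 < h^2 <
  1.\<close>

lemma wegner_chord_not_affine:
  assumes \<sigma>: "exp (\<i> * of_real (real n * u)) \<noteq> 1"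
    and affine: "\<And>t. a * \<Gamma> (of_real (t + u)) + b * \<Gamma> (of_real t) = c"
  shows "b = 0"
proof -
  define s :: complex where "s = exp (\<i> * of_real (real n * u))"
  let ?h = "of_real h :: complex"
  have s: "norm s = 1" "s \<noteq> 0" "s \<noteq> 1" using \<sigma> by (auto simp: s_def)
  have h0: "?h \<noteq> 0" using h by simp
  define F where "F t = a * exp (\<i> * (t + of_real u)) * \<theta> (s * Z t * ?h\<^sup>2) * \<theta> (Z t)
      + b * exp (\<i> * t) * \<theta> (Z t * ?h\<^sup>2) * \<theta> (s * Z t) - c * (\<theta> (Z t) * \<theta> (s * Z t))" for t
  have hol: "F holomorphic_on UNIV"
  proof -
    have "(\<lambda>t. \<theta> (Z t)) holomorphic_on UNIV" "(\<lambda>t. \<theta> (s * Z t)) holomorphic_on UNIV"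
      "(\<lambda>t. \<theta> (Z t * ?h\<^sup>2)) holomorphic_on UNIV" "(\<lambda>t. \<theta> (s * Z t * ?h\<^sup>2)) holomorphic_on UNIV"
      using holomorphic_theta_arg[of 1 UNIV] holomorphic_theta_arg[of s UNIV]
        holomorphic_theta_arg[of "?h\<^sup>2" UNIV] holomorphic_theta_arg[of "s * ?h\<^sup>2" UNIV] s h0
      by (simp_all add: mult_ac)
    moreover have "(\<lambda>t. exp (\<i> * t)) holomorphic_on UNIV"
      "(\<lambda>t. exp (\<i> * (t + of_real u))) holomorphic_on UNIV" by (intro holomorphic_intros)+
    ultimately show ?thesis unfolding F_def[abs_def]
      by (intro holomorphic_on_add holomorphic_on_diff holomorphic_on_mult holomorphic_on_const)
  qed
  have F_real: "F (of_real t) = 0" for t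
  proof -
    have z': "Z (of_real (t + u)) = s * Z (of_real t)"
      using wegner_arg_add[of "of_real t" "of_real u"] by (simp add: s_def mult_ac)
    have nz: "\<theta> (Z (of_real t)) \<noteq> 0" "\<theta> (s * Z (of_real t)) \<noteq> 0"
      using qtheta_wegner_arg_nonzero[of t] qtheta_wegner_arg_nonzero[of "t + u"] z' by auto
    have "F (of_real t) = (a * \<Gamma> (of_real (t + u)) + b * \<Gamma> (of_real t) - c)
        * (\<theta> (Z (of_real t)) * \<theta> (s * Z (of_real t)))"
      unfolding F_def wegner_def z' using nz by (simp add: field_simps)
    then show ?thesis using affine[of t] by simp
  qed
  have F0: "F t = 0" for t
  proof (rule analytic_continuation[OF hol _ _ _ _ _ _, of "range of_real" 0])
    show "(0::complex) islimpt range of_real"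
      unfolding islimpt_approachable
    proof (intro allI impI)
      fix e :: real assume "e > 0"
      then show "\<exists>x'\<in>range complex_of_real. x' \<noteq> 0 \<and> dist x' 0 < e"
        by (intro bexI[of _ "of_real (e / 2)"]) (auto simp del: of_real_divide)
    qed
  qed (use F_real in auto)
  define t where "t = Ln (- of_real (sqrt h / p)) / (\<i> * of_nat n)"
  have "exp (\<i> * of_nat n * t) = - of_real (sqrt h / p)"
    using n p sqrt_h by (simp add: t_def exp_Ln)
  then have "Z t = 1" using p sqrt_h by (simp add: wegner_arg_def)
  then have "b * exp (\<i> * t) * \<theta> (?h\<^sup>2) * \<theta> s = 0"
    using F0[of t] qtheta_1[OF nome(1,2)] by (simp add: F_def)
  moreover have "\<theta> s \<noteq> 0"
    using qtheta_zero_rotation[OF nome(1,2) qtheta_1[OF nome(1,2)], of s] s by auto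
  moreover have "\<theta> (?h\<^sup>2) \<noteq> 0"
  proof (rule qtheta_nonzero[OF nome(1,2)])
    have "(1 / 2)\<^sup>2 \<le> h\<^sup>2" using h by (intro power_mono) auto
    then have "1 / 4 \<le> h\<^sup>2" by (simp add: power_divide)
    then show "\<bar>- p\<^sup>2\<bar> < norm (?h\<^sup>2)" using nome(4) by (simp add: norm_power)
    have "h\<^sup>2 < 1" using h by (simp add: power_less_one_iff)
    then show "norm (?h\<^sup>2) < 1 \<or> norm (?h\<^sup>2) < 1 / \<bar>- p\<^sup>2\<bar> \<and> norm (?h\<^sup>2) \<noteq> 1"
      using h by (simp add: norm_power)
  qed
  ultimately show ?thesis by simp
qed

end

section \<open>Estimates for small nome, and the choice of h and u\<close>

context
  fixes q :: real
  assumes q0: "q \<noteq> 0" and q2: "\<bar>q\<bar> \<le> 1 / 2"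
begin

lemma norm_qphi_mult_minus_1_le:
  assumes "norm u \<le> b" "norm v \<le> b" "b \<le> 1 / 4"
  shows "norm (qphi q u * qphi q v - 1) \<le> 12 * b"
proof -
  have b0: "0 \<le> b" using assms(1) norm_ge_zero order_trans by blast
  have u: "norm (qphi q u - 1) \<le> 4 * b" and v: "norm (qphi q v - 1) \<le> 4 * b"
    using norm_qphi_minus_1_le[OF q0 q2, of u] norm_qphi_minus_1_le[OF q0 q2, of v] assms by auto
  have "qphi q u * qphi q v - 1 = (qphi q u - 1) * (qphi q v - 1) + (qphi q u - 1) + (qphi q v - 1)"
    by (simp add: algebra_simps)
  then have "norm (qphi q u * qphi q v - 1)
      \<le> norm ((qphi q u - 1) * (qphi q v - 1)) + norm (qphi q u - 1) + norm (qphi q v - 1)"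
    by (metis norm_triangle_mono norm_triangle_ineq order_refl)
  also have "\<dots> \<le> (4 * b) * (4 * b) + 4 * b + 4 * b"
    unfolding norm_mult using u v b0 by (intro add_mono mult_mono) auto
  also have "(4 * b) * (4 * b) \<le> 4 * b * 1"
    using assms(3) b0 by (intro mult_left_mono) auto
  finally show ?thesis by simp
qed

lemma norm_qtheta_minus_1_le:
  assumes "norm w \<le> b" "\<bar>q\<bar> / norm w \<le> b" "b \<le> 1 / 4"
  shows "norm (qtheta q w - 1) \<le> 12 * b"
  unfolding qtheta_def by (rule norm_qphi_mult_minus_1_le) (use assms in \<open>auto simp: norm_divide\<close>)

text \<open>Splitting off 1 - w leaves \<open>qphi\<close> at q w and q / w. So theta is 1 - w up to
  order q even where \<open>w\<close> itself is not small.\<close>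

lemma norm_qtheta_minus_linear_le:
  assumes "\<bar>q\<bar> * norm w \<le> b" "\<bar>q\<bar> / norm w \<le> b" "b \<le> 1 / 4"
  shows "norm (qtheta q w - (1 - w)) \<le> norm (1 - w) * (12 * b)"
proof -
  have "qtheta q w - (1 - w) = (1 - w) * (qphi q (of_real q * w) * qphi q (of_real q / w) - 1)"
    unfolding qtheta_def by (subst qphi_step[OF q0 q2]) (simp add: algebra_simps)
  then show ?thesis
    using norm_qphi_mult_minus_1_le[of "of_real q * w" b "of_real q / w"] assms
    by (simp add: norm_mult norm_divide mult_left_mono)
qed

lemma norm_qtheta_minus_linear_le':
  assumes "1 / 4 \<le> norm w" "norm w \<le> 5 / 4" "\<bar>q\<bar> \<le> 1 / 16"
  shows "norm (qtheta q w - (1 - w)) \<le> 108 * \<bar>q\<bar>"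
proof -
  have "norm (qtheta q w - (1 - w)) \<le> norm (1 - w) * (12 * (4 * \<bar>q\<bar>))"
  proof (rule norm_qtheta_minus_linear_le)
    show "\<bar>q\<bar> * norm w \<le> 4 * \<bar>q\<bar>" using mult_left_mono[OF assms(2), of "\<bar>q\<bar>"] by simp
    have "\<bar>q\<bar> / norm w \<le> \<bar>q\<bar> / (1 / 4)" using assms by (intro divide_left_mono) auto
    then show "\<bar>q\<bar> / norm w \<le> 4 * \<bar>q\<bar>" by simp
  qed (use assms in auto)
  also have "\<dots> \<le> (9 / 4) * (12 * (4 * \<bar>q\<bar>))"
    using norm_triangle_ineq4[of 1 w] assms by (intro mult_right_mono) auto
  finally show ?thesis by simp
qed

text \<open>Cauchy's estimate for theta minus its linear part on the disc of radius 1/4, which stays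
  in the annulus of the preceding bound; hence 432 = 4 * 108.\<close>

lemma norm_deriv_qtheta_plus_1_le:
  assumes "1 / 2 \<le> norm w" "norm w \<le> 1" "\<bar>q\<bar> \<le> 1 / 16"
  shows "norm (deriv (qtheta q) w + 1) \<le> 432 * \<bar>q\<bar>"
proof -
  have bnd: "1 / 4 \<le> norm x" "norm x \<le> 5 / 4" if "x \<in> cball w (1 / 4)" for x
    using that assms norm_triangle_ineq2[of w x] norm_triangle_ineq2[of x w]
    by (auto simp: dist_norm norm_minus_commute)
  define F where "F x = qtheta q x - (1 - x)" for x
  have hol: "F holomorphic_on - {0}"
    unfolding F_def[abs_def] by (intro holomorphic_intros holomorphic_qtheta[OF q0 q2])
  have sub: "cball w (1 / 4) \<subseteq> - {0}" using bnd(1) by fastforce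
  have "norm ((deriv ^^ 1) F w) \<le> fact 1 * (108 * \<bar>q\<bar>) / (1 / 4) ^ 1"
  proof (rule Cauchy_inequality)
    show "F holomorphic_on ball w (1 / 4)"
      using hol sub ball_subset_cball holomorphic_on_subset by blast
    show "continuous_on (cball w (1 / 4)) F"
      using hol sub holomorphic_on_subset holomorphic_on_imp_continuous_on by blast
    show "norm (F x) \<le> 108 * \<bar>q\<bar>" if "norm (w - x) = 1 / 4" for x
      unfolding F_def using bnd[of x] that assms(3)
      by (intro norm_qtheta_minus_linear_le') (auto simp: dist_norm)
  qed auto
  moreover have "deriv F w = deriv (qtheta q) w + 1"
  proof -
    have "w \<in> - {0}" using assms by auto
    then have "(qtheta q has_field_derivative deriv (qtheta q) w) (at w)"
      using holomorphic_derivI[OF holomorphic_qtheta[OF q0 q2], of w] by auto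
    then show ?thesis unfolding F_def[abs_def]
      by (intro DERIV_imp_deriv) (auto intro!: derivative_eq_intros)
  qed
  ultimately show ?thesis by simp
qed

lemma Im_deriv_qtheta_of_real:
  assumes "x \<noteq> 0"
  shows "Im (deriv (qtheta q) (of_real x)) = 0"
proof -
  have "(qtheta q has_field_derivative deriv (qtheta q) (of_real x)) (at (of_real x))"
    using holomorphic_derivI[OF holomorphic_qtheta[OF q0 q2], of "of_real x"] assms by auto
  from has_vector_derivative_real_field[OF this]
  have "((\<lambda>x. Im (qtheta q (of_real x))) has_real_derivative Im (deriv (qtheta q) (of_real x))) (at x)"
    by (auto simp: has_real_derivative_iff_has_vector_derivative
        intro: bounded_linear.has_vector_derivative[OF bounded_linear_Im])
  moreover have "Im (qtheta q (of_real x)) = 0" for x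
    using cnj_qtheta[OF q0 q2, of "of_real x"] by (simp add: complex_eq_iff)
  ultimately show ?thesis
    using DERIV_unique[of "\<lambda>x. 0::real" _ x 0] by simp
qed

end

text \<open>Because of this the vanishing of the defect is a single real equation, open to the
  intermediate value theorem.\<close>

lemma Im_wegner_defect:
  assumes "wegner_curve n p h"
  shows "Im (wegner_defect n p h) = 0"
proof -
  interpret wegner_curve n p h by fact
  have "Im (\<theta> (- of_real h)) = 0"
    using cnj_qtheta[OF nome(1,2), of "- of_real h"] by (simp add: complex_eq_iff)
  moreover have "Im (deriv \<theta> (- of_real h)) = 0"
    using Im_deriv_qtheta_of_real[OF nome(1,2), of "- h"] h by simp
  ultimately show ?thesis by (simp add: wegner_defect_def)
qed

text \<open>At nome 0 theta is 1 - w, and the defect becomes (1 / n - 1) / 2 * (1 + h) + h, with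
  zero (n - 1) / (n + 1). For n \<ge> 4 this is at most -1/16 at h = 1/2, and it equals 1 / (2 n) at
  h = n / (n + 1). The nome changes it by at most 500 p^2.\<close>

lemma wegner_defect_zero:
  assumes n: "n \<ge> 4" and p: "0 < p" "p \<le> 1 / (1000 * real n)"
  obtains h where "1 / 2 \<le> h" "h \<le> real n / (real n + 1)" "wegner_defect n p h = 0"
proof -
  let ?\<theta> = "qtheta (- p\<^sup>2)" and ?b = "real n / (real n + 1)"
  have b: "1 / 2 \<le> ?b" "?b < 1" using n by (auto simp: field_simps)
  have p1: "p \<le> 1 / 4000" by (rule order_trans[OF p(2)]) (use n in \<open>simp add: field_simps\<close>)
  have curve: "wegner_curve n p h" if "1 / 2 \<le> h" "h \<le> ?b" for h
    using n p p1 that order.strict_trans1[OF that(2) b(2)] by unfold_locales auto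
  interpret b: wegner_curve n p ?b by (rule curve) (use b in auto)
  have p2: "p\<^sup>2 \<le> p / 4000" using mult_left_mono[OF p1, of p] p by (simp add: power2_eq_square)
  have "0 < 1 / real n" "1 / (2 * real n) = 1 / real n / 2" "1 / (1000 * real n) = 1 / real n / 1000"
    using n by auto
  then have p3: "500 * p\<^sup>2 < 1 / (2 * real n)" "500 * p\<^sup>2 < 1 / 16" "p\<^sup>2 \<le> 1 / 16"
    using p p1 p2 by linarith+
  have approx: "\<bar>Re (wegner_defect n p h) - ((1 / real n - 1) / 2 * (1 + h) + h)\<bar> \<le> 500 * p\<^sup>2"
    if h: "1 / 2 \<le> h" "h \<le> ?b" for h
  proof -
    have h1: "h < 1" using h(2) b(2) by (rule order.strict_trans1)
    have "norm (?\<theta> (- of_real h) - (1 - - of_real h)) \<le> 108 * \<bar>- p\<^sup>2\<bar>"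
      by (rule norm_qtheta_minus_linear_le'[OF b.nome(1,2)]) (use h(1) h1 p3 in auto)
    then have "\<bar>Re (?\<theta> (- of_real h) - (1 - - of_real h))\<bar> \<le> 108 * p\<^sup>2"
      using abs_Re_le_cmod order_trans by fastforce
    then have 1: "\<bar>Re (?\<theta> (- of_real h)) - (1 + h)\<bar> \<le> 108 * p\<^sup>2" by simp
    have "norm (deriv ?\<theta> (- of_real h) + 1) \<le> 432 * \<bar>- p\<^sup>2\<bar>"
      by (rule norm_deriv_qtheta_plus_1_le[OF b.nome(1,2)]) (use h(1) h1 p3 in auto)
    then have "\<bar>Re (deriv ?\<theta> (- of_real h) + 1)\<bar> \<le> 432 * p\<^sup>2"
      using abs_Re_le_cmod order_trans by fastforce
    then have 2: "\<bar>Re (deriv ?\<theta> (- of_real h)) + 1\<bar> \<le> 432 * p\<^sup>2" by simp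
    let ?c = "(1 / real n - 1) / 2"
    have c: "\<bar>?c\<bar> \<le> 1 / 2" using n by (auto simp: field_simps)
    have "Re (wegner_defect n p h) - (?c * (1 + h) + h)
        = ?c * (Re (?\<theta> (- of_real h)) - (1 + h)) - h * (Re (deriv ?\<theta> (- of_real h)) + 1)"
      by (simp add: wegner_defect_def algebra_simps)
    also have "\<bar>\<dots>\<bar> \<le> \<bar>?c\<bar> * \<bar>Re (?\<theta> (- of_real h)) - (1 + h)\<bar> + h * \<bar>Re (deriv ?\<theta> (- of_real h)) + 1\<bar>"
      by (rule order_trans[OF abs_triangle_ineq4]) (use h in \<open>simp add: abs_mult\<close>)
    also have "\<dots> \<le> 1 / 2 * (108 * p\<^sup>2) + 1 * (432 * p\<^sup>2)"
      using c 1 2 h(1) h1 by (intro add_mono mult_mono) auto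
    also have "\<dots> \<le> 500 * p\<^sup>2" by simp
    finally show ?thesis .
  qed
  have "Re (wegner_defect n p (1 / 2)) \<le> 0"
  proof -
    have "(1 / real n - 1) / 2 * (1 + 1 / 2) + 1 / 2 \<le> - (1 / 16 :: real)" using n by (simp add: field_simps)
    then show ?thesis using approx[of "1/2"] b p3 by (simp add: abs_le_iff)
  qed
  moreover have "0 \<le> Re (wegner_defect n p ?b)"
  proof -
    have "(1 / real n - 1) / 2 * (1 + ?b) + ?b = 1 / (2 * real n)"
      using n by (simp add: divide_simps) (simp add: algebra_simps)?
    then show ?thesis using approx[of ?b] b p3 by (simp add: abs_le_iff)
  qed
  moreover have "continuous_on {1 / 2..?b} (\<lambda>h. Re (wegner_defect n p h))"
  proof -
    have hol: "?\<theta> holomorphic_on - {0}" by (rule holomorphic_qtheta[OF b.nome(1,2)])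
    have dh: "deriv ?\<theta> holomorphic_on - {0}" by (rule holomorphic_deriv[OF hol]) auto
    have sub: "(\<lambda>h. - of_real h :: complex) ` {1 / 2..?b} \<subseteq> - {0}" by auto
    have "continuous_on {1 / 2..?b} (\<lambda>h. ?\<theta> (- of_real h))"
      "continuous_on {1 / 2..?b} (\<lambda>h. deriv ?\<theta> (- of_real h))"
      using sub by (auto intro!: continuous_on_compose2[OF holomorphic_on_imp_continuous_on[OF hol]]
          continuous_on_compose2[OF holomorphic_on_imp_continuous_on[OF dh]] continuous_intros)
    then show ?thesis unfolding wegner_defect_def by (intro continuous_intros)
  qed
  ultimately obtain h where h: "1 / 2 \<le> h" "h \<le> ?b" "Re (wegner_defect n p h) = 0"
    using IVT'[of "\<lambda>h. Re (wegner_defect n p h)" "1/2" 0 ?b] b by auto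
  then have "wegner_defect n p h = 0"
    using Im_wegner_defect[OF curve] by (simp add: complex_eq_iff)
  then show ?thesis using that h by blast
qed

context wegner_curve
begin

text \<open>At u = 2 \<pi> / n and u = 3 \<pi> / n the number exp (i n u) is 1 and -1, so the theta
  factor is real and positive. The sign of \<open>Im (Y u)\<close> is that of the sine of \<pi> / n
  - \<pi> and of 3 \<pi> / (2 n) - 3 \<pi> / 2: negative, then positive. The interval avoids the
  trivial solution u = 0, and in its interior exp (i n u) \<noteq> 1.\<close>

lemma wegner_phase_zero:
  assumes n4: "n \<ge> 4" and small: "108 * p\<^sup>2 < 1 / (real n + 1)" and hb: "h \<le> real n / (real n + 1)"
  obtains u where "2 * pi / n < u" "u < 3 * pi / n" "Im (Y u) = 0" "exp (\<i> * of_real (real n * u)) \<noteq> 1"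
proof -
  have p16: "\<bar>- p\<^sup>2\<bar> \<le> 1 / 16"
  proof -
    have "1 / (real n + 1) \<le> 1 / 5" using n4 by (simp add: field_simps)
    then have "108 * p\<^sup>2 < 1 / 5" using small by linarith
    then show ?thesis by simp
  qed
  have h1: "1 / (real n + 1) \<le> 1 - h" using hb n4 by (simp add: field_simps)
  have real: "\<theta> (of_real x) = of_real (Re (\<theta> (of_real x)))" for x
    using cnj_qtheta[OF nome(1,2), of "of_real x"] by (simp add: complex_eq_iff)
  \<comment> \<open>The bound h \<le> n / (n + 1) keeps 1 - x at least 1 / (n + 1), more than the
    error 108 p^2 of the linear approximation.\<close>
  have pos: "0 < Re (\<theta> (of_real x))" if "\<bar>x\<bar> = h" for x
  proof -
    have "norm (\<theta> (of_real x) - (1 - of_real x)) \<le> 108 * \<bar>- p\<^sup>2\<bar>"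
      by (rule norm_qtheta_minus_linear_le'[OF nome(1,2)]) (use that h p16 in auto)
    then have "\<bar>Re (\<theta> (of_real x) - (1 - of_real x))\<bar> < 1 / (real n + 1)"
      using small abs_Re_le_cmod[of "\<theta> (of_real x) - (1 - of_real x)"] by simp
    moreover have "1 - x \<ge> 1 / (real n + 1)" using h1 that by linarith
    ultimately show ?thesis by (simp add: abs_less_iff)
  qed
  have np: "0 < real n" using n4 by simp
  have Y: "Y u = cis ((1 - real n) * u / 2) * \<theta> (- cis (real n * u) * of_real h)" for u
    by (simp add: wegner_phase_def cis_conv_exp)
  have lo: "Im (Y (2 * pi / n)) < 0"
  proof -
    have e: "(1 - real n) * (2 * pi / n) / 2 = pi / n - pi" using np by (simp add: field_simps)
    have s: "sin (pi / n) > 0" using n4 by (intro sin_gt_zero) (auto simp: field_simps)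
    have "Y (2 * pi / n) = cis (pi / n - pi) * \<theta> (of_real (- h))"
      unfolding Y e using np by simp
    also have "\<dots> = cis (pi / n - pi) * of_real (Re (\<theta> (of_real (- h))))"
      using real by metis
    finally have "Im (Y (2 * pi / n)) = - sin (pi / n) * Re (\<theta> (of_real (- h)))"
      by (simp add: sin_diff)
    moreover have "0 < Re (\<theta> (of_real (- h)))" by (rule pos) (use h in auto)
    ultimately show ?thesis using s by (simp add: mult_neg_pos)
  qed
  have hi: "Im (Y (3 * pi / n)) > 0"
  proof -
    have e: "(1 - real n) * (3 * pi / n) / 2 = 3 * pi / (2 * n) - 3 * pi / 2" using np by (simp add: field_simps)
    have s: "cos (3 * pi / (2 * n)) > 0" using n4 by (intro cos_gt_zero) (auto simp: field_simps)
    have "3 * pi / 2 = 3 / 2 * pi" by simp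
    then have c3: "cos (3 * pi / 2) = 0" "sin (3 * pi / 2) = -1"
      by (simp_all only: cos_3over2_pi sin_3over2_pi)
    have "cis (3 * pi) = cis (2 * pi) * cis pi" by (simp only: cis_mult) simp
    then have "cis (3 * pi) = -1" by simp
    then have "Y (3 * pi / n) = cis (3 * pi / (2 * n) - 3 * pi / 2) * \<theta> (of_real h)"
      unfolding Y e using np by simp
    also have "\<dots> = cis (3 * pi / (2 * n) - 3 * pi / 2) * of_real (Re (\<theta> (of_real h)))"
      using real by metis
    finally have "Im (Y (3 * pi / n)) = cos (3 * pi / (2 * n)) * Re (\<theta> (of_real h))"
      by (simp add: sin_diff c3)
    moreover have "0 < Re (\<theta> (of_real h))" by (rule pos) (use h in auto)
    ultimately show ?thesis using s by simp
  qed
  have "continuous_on {2 * pi / n..3 * pi / n} (\<lambda>u. Im (Y u))"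
  proof -
    have "continuous_on {2 * pi / n..3 * pi / n} (\<lambda>u. \<theta> (- cis (real n * u) * of_real h))"
      by (rule continuous_on_compose2[OF holomorphic_on_imp_continuous_on[OF holomorphic_qtheta[OF nome(1,2)]]])
         (use h in \<open>auto intro!: continuous_intros\<close>)
    then show ?thesis unfolding Y by (intro continuous_intros) auto
  qed
  then obtain u where u: "2 * pi / n \<le> u" "u \<le> 3 * pi / n" "Im (Y u) = 0"
    using IVT'[of "\<lambda>u. Im (Y u)" "2 * pi / n" 0 "3 * pi / n"] lo hi np by (auto simp: divide_right_mono)
  have u': "2 * pi / n < u" "u < 3 * pi / n"
    using u lo hi by (metis less_irrefl order_le_less)+
  have "exp (\<i> * of_real (real n * u)) \<noteq> 1"
  proof
    assume "exp (\<i> * of_real (real n * u)) = 1"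
    then have "sin (real n * u) = 0"
      by (simp only: cis_conv_exp[symmetric]) (simp add: complex_eq_iff)
    moreover have "sin (real n * u) = sin (real n * u - 2 * pi)" by (simp add: sin_diff)
    moreover have "sin (real n * u - 2 * pi) > 0"
      by (rule sin_gt_zero) (use u' np in \<open>simp_all add: field_simps\<close>)
    ultimately show False by simp
  qed
  then show ?thesis using that u' u by blast
qed

text \<open>On the disc of radius 1 / n about a real point \<bar>n Im x\<bar> \<le> 1, so
  \<bar>Z\<bar> stays between p / 3 and 6 p and the theta quotient is 1 up to order p. Cauchy's
  estimate on this disc costs a factor n for the derivative.\<close>

lemma wegner_near_circle:
  assumes small: "p \<le> 1 / 4000" and \<epsilon>: "2000 * real n * p \<le> \<epsilon>"
  shows "norm (\<Gamma> (of_real t) - cis t) \<le> \<epsilon>" "norm (deriv \<Gamma> (of_real t) - \<i> * cis t) \<le> \<epsilon>"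
proof -
  let ?S = "cball (complex_of_real t) (1 / n)"
  have np: "1 \<le> real n" using n by simp
  define G where "G x = \<Gamma> x - exp (\<i> * x)" for x
  have main: "norm (G x) \<le> 2000 * p \<and> x \<in> wegner_domain n p h" if x: "x \<in> ?S" for x
  proof -
    have "\<bar>Im (complex_of_real t - x)\<bar> \<le> 1 / n"
      using x abs_Im_le_cmod[of "complex_of_real t - x"] by (auto simp: dist_norm)
    then have im: "\<bar>Im x\<bar> \<le> 1 / n" by simp
    then have nim: "\<bar>real n * Im x\<bar> \<le> 1" using np by (simp add: abs_mult field_simps)
    have e3: "exp (1::real) \<le> 3" using exp_le by simp
    have ex: "exp (- (real n * Im x)) \<le> 3" "1 / 3 \<le> exp (- (real n * Im x))"
    proof -
      have "exp (- (real n * Im x)) \<le> exp 1" using nim by (simp add: abs_le_iff)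
      then show "exp (- (real n * Im x)) \<le> 3" using e3 by linarith
      have "exp (real n * Im x) \<le> exp 1" using nim by (simp add: abs_le_iff)
      then have "exp (real n * Im x) \<le> 3" using e3 by linarith
      then show "1 / 3 \<le> exp (- (real n * Im x))" by (simp add: exp_minus field_simps)
    qed
    let ?z = "Z x" and ?h = "of_real h :: complex"
    have ps: "p \<le> p / sqrt h" "p / sqrt h \<le> 2 * p" using sqrt_h p by (auto simp: field_simps)
    have zu: "norm ?z \<le> 6 * p"
    proof -
      have "p / sqrt h * exp (- (real n * Im x)) \<le> 2 * p * 3" using ps ex p sqrt_h by (intro mult_mono) auto
      then show ?thesis by (simp add: norm_wegner_arg)
    qed
    have zl: "p / 3 \<le> norm ?z"
    proof -
      have "p * (1 / 3) \<le> p / sqrt h * exp (- (real n * Im x))" using ps ex p sqrt_h by (intro mult_mono) auto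
      then show ?thesis by (simp add: norm_wegner_arg)
    qed
    have h2: "1 / 4 \<le> h\<^sup>2" "h\<^sup>2 \<le> 1"
      using power_mono[of "1/2" h 2] power_le_one[of h 2] h by (simp_all add: power_divide)
    have t1: "norm (\<theta> ?z - 1) \<le> 12 * (12 * p)"
    proof (rule norm_qtheta_minus_1_le[OF nome(1,2)])
      have "p\<^sup>2 / norm ?z \<le> p\<^sup>2 / (p / 3)" using zl p wegner_arg_nonzero[of x] by (intro divide_left_mono) auto
      then show "\<bar>- p\<^sup>2\<bar> / norm ?z \<le> 12 * p" using p by (simp add: power2_eq_square)
    qed (use zu p small in auto)
    have t2: "norm (\<theta> (?z * ?h ^ 2) - 1) \<le> 12 * (12 * p)"
    proof (rule norm_qtheta_minus_1_le[OF nome(1,2)])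
      have nz: "norm (?z * ?h ^ 2) = norm ?z * h\<^sup>2" by (simp add: norm_mult norm_power)
      have "norm ?z * h\<^sup>2 \<le> 6 * p * 1" using zu h2 p by (intro mult_mono) auto
      then show "norm (?z * ?h ^ 2) \<le> 12 * p" using nz p by simp
      have "p / 3 * (1 / 4) \<le> norm ?z * h\<^sup>2" using zl h2 p by (intro mult_mono) auto
      then have "p\<^sup>2 / (norm ?z * h\<^sup>2) \<le> p\<^sup>2 / (p / 12)"
        using p h wegner_arg_nonzero[of x] by (intro divide_left_mono) auto
      then show "\<bar>- p\<^sup>2\<bar> / norm (?z * ?h ^ 2) \<le> 12 * p" using p nz by (simp add: power2_eq_square)
    qed (use p small in auto)
    have t3: "1 / 2 \<le> norm (\<theta> ?z)"
      using t1 small norm_triangle_ineq3[of "\<theta> ?z" 1] by (simp add: abs_le_iff)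
    then have dom: "x \<in> wegner_domain n p h" by (auto simp: wegner_domain_def)
    have "norm (\<theta> (?z * ?h ^ 2) - \<theta> ?z) \<le> 288 * p"
      using t1 t2 norm_triangle_ineq4[of "\<theta> (?z * ?h ^ 2) - 1" "\<theta> ?z - 1"] by simp
    then have "norm (\<theta> (?z * ?h ^ 2) - \<theta> ?z) / norm (\<theta> ?z) \<le> 288 * p / (1 / 2)"
      using t3 p by (intro frac_le) auto
    moreover have "\<theta> (?z * ?h ^ 2) / \<theta> ?z - 1 = (\<theta> (?z * ?h ^ 2) - \<theta> ?z) / \<theta> ?z"
      using t3 by (auto simp: diff_divide_distrib)
    ultimately have E: "norm (\<theta> (?z * ?h ^ 2) / \<theta> ?z - 1) \<le> 576 * p" by (simp add: norm_divide)
    have "1 / real n \<le> 1" using np by simp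
    then have "exp (- Im x) \<le> exp 1" using im by (simp add: abs_le_iff) 
    then have "exp (- Im x) \<le> 3" using e3 by linarith
    then have "norm (exp (\<i> * x)) \<le> 3" by simp
    moreover have "G x = exp (\<i> * x) * (\<theta> (?z * ?h ^ 2) / \<theta> ?z - 1)"
      by (simp add: G_def wegner_def algebra_simps)
    ultimately have "norm (G x) \<le> 3 * (576 * p)"
      using E by (simp only: norm_mult) (intro mult_mono; simp)
    then show ?thesis using dom p by simp
  qed
  have pe: "2000 * p \<le> \<epsilon>"
  proof -
    have "1 * (2000 * p) \<le> real n * (2000 * p)" by (rule mult_right_mono[OF np]) (use p in simp)
    then show ?thesis using \<epsilon> by linarith
  qed
  have "norm (G (of_real t)) \<le> \<epsilon>" using main[of "of_real t"] pe by simp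
  then show "norm (\<Gamma> (of_real t) - cis t) \<le> \<epsilon>" by (simp add: G_def cis_conv_exp)
  have holG: "G holomorphic_on wegner_domain n p h"
    unfolding G_def[abs_def] by (intro holomorphic_on_diff holomorphic_wegner holomorphic_intros)
  have "norm ((deriv ^^ 1) G (of_real t)) \<le> fact 1 * (2000 * p) / (1 / n) ^ 1"
  proof (rule Cauchy_inequality)
    show "G holomorphic_on ball (of_real t) (1 / n)"
      using holG main ball_subset_cball holomorphic_on_subset by blast
    show "continuous_on ?S G"
      using holG main holomorphic_on_subset holomorphic_on_imp_continuous_on by blast
    show "norm (G x) \<le> 2000 * p" if "norm (of_real t - x) = 1 / n" for x
      using main[of x] that by (simp add: dist_norm)
  qed (use np in auto)
  moreover have "deriv G (of_real t) = deriv \<Gamma> (of_real t) - \<i> * cis t"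
    unfolding G_def[abs_def] cis_conv_exp
    by (rule DERIV_imp_deriv) (auto intro!: derivative_eq_intros wegner_has_derivative)
  ultimately show "norm (deriv \<Gamma> (of_real t) - \<i> * cis t) \<le> \<epsilon>"
    using \<epsilon> np by (simp add: mult_ac)
qed

end

section \<open>Tables from nearly circular centre curves\<close>

lemma abs_sin_ge:
  fixes x :: real
  assumes "\<bar>x\<bar> \<le> pi / 2"
  shows "\<bar>x\<bar> / 4 \<le> \<bar>sin x\<bar>"
proof -
  have pos: "y / 4 \<le> sin y" if y: "0 < y" "y \<le> pi / 2" for y :: real
  proof (cases "y \<le> pi / 3")
    case True
    obtain z where z: "0 < z" "z < y" "sin y - sin 0 = (y - 0) * cos z"
      using MVT2[of 0 y sin cos] y by (auto intro!: derivative_eq_intros)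
    have "cos (pi / 3) \<le> cos z" using z True by (intro cos_monotone_0_pi_le) auto
    then have "y * (1 / 2) \<le> y * cos z" using y by (intro mult_left_mono) (auto simp: cos_60)
    then show ?thesis using z y by simp
  next
    case False
    have "sin (pi / 6) \<le> sin y" using False y by (intro sin_monotone_2pi_le) auto
    then show ?thesis using y pi_less_4 by (simp add: sin_30)
  qed
  consider "x = 0" | "0 < x" | "x < 0" by linarith
  then show ?thesis
    using pos[of x] pos[of "- x"] assms by cases (auto simp: abs_if)
qed

lemma norm_cis_diff: "norm (cis s - cis t) = 2 * \<bar>sin ((s - t) / 2)\<bar>"
proof -
  have "cis s - cis t = cis ((s + t) / 2) * (cis ((s - t) / 2) - cis (- ((s - t) / 2)))"
    by (simp add: right_diff_distrib cis_mult field_simps)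
  also have "cis ((s - t) / 2) - cis (- ((s - t) / 2)) = 2 * \<i> * of_real (sin ((s - t) / 2))"
    by (simp add: complex_eq_iff)
  finally show ?thesis by (simp add: norm_mult)
qed

lemma norm_cis_diff_ge:
  assumes "\<bar>s - t\<bar> \<le> pi"
  shows "\<bar>s - t\<bar> / 4 \<le> norm (cis s - cis t)"
  using abs_sin_ge[of "(s - t) / 2"] assms by (simp add: norm_cis_diff)

lemma norm_cis_diff_le: "norm (cis s - cis t) \<le> \<bar>s - t\<bar>"
  using abs_sin_x_le_abs_x[of "(s - t) / 2"] by (simp add: norm_cis_diff)

lemma cis_eq_1_imp:
  assumes "cis x = 1" "\<bar>x\<bar> < 2 * pi"
  shows "x = 0"
proof -
  have "cos x = 1" using assms(1) by (simp add: complex_eq_iff)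
  then obtain k :: int where k: "x = k * 2 * pi" using cos_one_2pi_int by auto
  then have "\<bar>of_int k :: real\<bar> * (2 * pi) < 1 * (2 * pi)" using assms(2) by (simp add: abs_mult mult_ac)
  then have "\<bar>of_int k :: real\<bar> < 1" by (subst (asm) mult_less_cancel_right) auto
  then show ?thesis using k by simp
qed

text \<open>Smallness of the perturbation: \<open>R\<close> and \<open>r\<close> are the radii of the table and of the Larmor
  circles when the centre curve is the unit circle, \<open>e\<close> and \<open>d\<close> bound the errors of the table and
  of its unit tangent.\<close>

definition gutkin_small :: "real \<Rightarrow> real \<Rightarrow> real \<Rightarrow> bool" where
  "gutkin_small \<delta> \<theta> \<epsilon> \<longleftrightarrow>
    (let R = sin (\<theta> + \<delta>) / sin \<delta>; r = sin \<theta> / sin \<delta>; e = \<epsilon> / sin \<delta>; d = 4 * \<epsilon> / sin \<theta> in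
      \<epsilon> < sin \<theta> / 2 \<and>
      e + R * d < R \<and>
      e < R / 4 \<and>
      2 * (R * (e + \<epsilon>) + (R + 1) * e) + 2 * e * (e + \<epsilon>) < R * sin (\<theta> / 2) / 2 \<and>
      2 * (R * (e + \<epsilon>) + (R + 1) * e) + 2 * e * (e + \<epsilon>) < R * cos (\<theta> / 2) / 2 \<and>
      8 * d < pi - \<theta> - \<delta> \<and> 8 * d < 2 * (\<theta> + \<delta>) \<and>
      \<bar>1 - r\<bar> + e + \<epsilon> + (r + e) * d + e < R)"

text \<open>All conditions are strict inequalities between quantities continuous in the angle and in
  \<epsilon>, and they hold at \<epsilon> = 0. There only the last one, \<bar>1 - r\<bar> < R, takes
  an argument.\<close>

lemma gutkin_small_tendsto:
  assumes "0 < \<theta>" "0 < \<delta>" "\<theta> + \<delta> < pi"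
    and \<theta>: "f \<longlonglongrightarrow> \<theta>" and \<epsilon>: "g \<longlonglongrightarrow> 0"
  shows "\<forall>\<^sub>F m in sequentially. gutkin_small \<delta> (f m) (g m)"
proof -
  have pos: "0 < sin \<theta>" "0 < sin \<delta>" "0 < sin (\<theta> + \<delta>)" "0 < sin (\<theta> / 2)" "0 < cos (\<theta> / 2)"
    using assms by (auto intro!: sin_gt_zero cos_gt_zero)
  let ?R = "sin (\<theta> + \<delta>) / sin \<delta>" and ?r = "sin \<theta> / sin \<delta>"
  \<comment> \<open>Triangle inequality for the sides 1, r, R; the identity below is the law of
    cosines for the angle \<pi> - \<theta> - \<delta> between the sides 1 and r.\<close>
  have tri: "\<bar>1 - ?r\<bar> < ?R"
  proof -
    have "?R\<^sup>2 - (1 - ?r)\<^sup>2 = 2 * ?r * (1 + cos (\<theta> + \<delta>))"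
    proof -
      have "sin \<delta> = sin (\<theta> + \<delta>) * cos \<theta> - cos (\<theta> + \<delta>) * sin \<theta>"
        using sin_diff[of "\<theta> + \<delta>" \<theta>] by simp
      then have "(sin \<delta>)\<^sup>2 = (sin (\<theta> + \<delta>))\<^sup>2 - (sin \<theta>)\<^sup>2 - 2 * sin \<theta> * cos (\<theta> + \<delta>) * sin \<delta>"
        using sin_cos_squared_add[of \<theta>] sin_cos_squared_add[of "\<theta> + \<delta>"] by algebra
      then have "(sin (\<theta> + \<delta>))\<^sup>2 - (sin \<delta> - sin \<theta>)\<^sup>2 = 2 * sin \<theta> * (1 + cos (\<theta> + \<delta>)) * sin \<delta>"
        by (simp add: power2_diff algebra_simps) (simp add: power2_eq_square)?
      moreover have "?R\<^sup>2 - (1 - ?r)\<^sup>2 = ((sin (\<theta> + \<delta>))\<^sup>2 - (sin \<delta> - sin \<theta>)\<^sup>2) / (sin \<delta>)\<^sup>2"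
      proof -
        have "1 - ?r = (sin \<delta> - sin \<theta>) / sin \<delta>" using pos by (simp add: diff_divide_distrib)
        then show ?thesis unfolding \<open>1 - ?r = _\<close> power_divide by (simp only: diff_divide_distrib)
      qed
      ultimately show ?thesis using pos by (simp add: power2_eq_square)
    qed
    moreover have "0 < 1 + cos (\<theta> + \<delta>)"
      using cos_monotone_0_pi[of "\<theta> + \<delta>" pi] assms by simp
    ultimately have "(1 - ?r)\<^sup>2 < ?R\<^sup>2" using pos
      by (metis diff_gt_0_iff_gt divide_pos_pos mult_pos_pos zero_less_numeral)
    then have "\<bar>1 - ?r\<bar> < \<bar>?R\<bar>" using abs_le_square_iff[of ?R "1 - ?r"] by linarith
    then show ?thesis using pos by simp
  qed
  have R: "0 < ?R" using pos by simp
  let ?e = "\<lambda>m. g m / sin \<delta>" and ?d = "\<lambda>m. 4 * g m / sin (f m)" and ?Rm = "\<lambda>m. sin (f m + \<delta>) / sin \<delta>"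
    and ?rm = "\<lambda>m. sin (f m) / sin \<delta>"
  have e: "?e \<longlonglongrightarrow> 0" and d: "?d \<longlonglongrightarrow> 0" and Rm: "?Rm \<longlonglongrightarrow> ?R" and rm: "?rm \<longlonglongrightarrow> ?r"
    using \<theta> \<epsilon> pos by (auto intro!: tendsto_eq_intros)
  have less: "\<forall>\<^sub>F m in sequentially. a m < b m"
    if "a \<longlonglongrightarrow> A" "b \<longlonglongrightarrow> B" "A < B" for a b :: "nat \<Rightarrow> real" and A B
  proof -
    obtain M where "A < M" "M < B" using \<open>A < B\<close> dense by blast
    then have "\<forall>\<^sub>F m in sequentially. a m < M" "\<forall>\<^sub>F m in sequentially. M < b m"
      using \<open>a \<longlonglongrightarrow> A\<close> \<open>b \<longlonglongrightarrow> B\<close> order_tendstoD by metis+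
    then show ?thesis by eventually_elim simp
  qed
  have "\<forall>\<^sub>F m in sequentially. g m < sin (f m) / 2"
    by (rule less[OF \<epsilon>, of _ "sin \<theta> / 2"]) (use \<theta> pos in \<open>auto intro!: tendsto_eq_intros\<close>)
  moreover have "\<forall>\<^sub>F m in sequentially. ?e m + ?Rm m * ?d m < ?Rm m"
    by (rule less[OF tendsto_add[OF e tendsto_mult[OF Rm d]] Rm]) (use R in simp)
  moreover have "\<forall>\<^sub>F m in sequentially. ?e m < ?Rm m / 4"
    by (rule less[OF e tendsto_divide[OF Rm tendsto_const]]) (use R in auto)
  moreover have L: "(\<lambda>m. 2 * (?Rm m * (?e m + g m) + (?Rm m + 1) * ?e m) + 2 * ?e m * (?e m + g m))
      \<longlonglongrightarrow> 2 * (?R * (0 + 0) + (?R + 1) * 0) + 2 * 0 * (0 + 0)"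
    by (intro tendsto_intros e Rm \<epsilon>)
  have "\<forall>\<^sub>F m in sequentially. 2 * (?Rm m * (?e m + g m) + (?Rm m + 1) * ?e m) + 2 * ?e m * (?e m + g m)
      < ?Rm m * sin (f m / 2) / 2"
    by (rule less[OF L, of _ "?R * sin (\<theta> / 2) / 2"])
       (use R pos in \<open>auto intro!: tendsto_intros Rm \<theta>\<close>)
  moreover have "\<forall>\<^sub>F m in sequentially. 2 * (?Rm m * (?e m + g m) + (?Rm m + 1) * ?e m) + 2 * ?e m * (?e m + g m)
      < ?Rm m * cos (f m / 2) / 2"
    by (rule less[OF L, of _ "?R * cos (\<theta> / 2) / 2"])
       (use R pos in \<open>auto intro!: tendsto_intros Rm \<theta>\<close>)
  moreover have "\<forall>\<^sub>F m in sequentially. 8 * ?d m < pi - f m - \<delta>"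
    by (rule less[OF tendsto_mult[OF tendsto_const d], of _ "pi - \<theta> - \<delta>"])
       (use assms in \<open>auto intro!: tendsto_intros\<close>)
  moreover have "\<forall>\<^sub>F m in sequentially. 8 * ?d m < 2 * (f m + \<delta>)"
    by (rule less[OF tendsto_mult[OF tendsto_const d], of _ "2 * (\<theta> + \<delta>)"])
       (use assms in \<open>auto intro!: tendsto_intros\<close>)
  moreover have "\<forall>\<^sub>F m in sequentially. \<bar>1 - ?rm m\<bar> + ?e m + g m + (?rm m + ?e m) * ?d m + ?e m < ?Rm m"
  proof (rule less[OF _ Rm])
    show "(\<lambda>m. \<bar>1 - ?rm m\<bar> + ?e m + g m + (?rm m + ?e m) * ?d m + ?e m)
        \<longlonglongrightarrow> \<bar>1 - ?r\<bar> + 0 + 0 + (?r + 0) * 0 + 0"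
      by (intro tendsto_intros rm e d \<epsilon>)
  qed (use tri in simp)
  ultimately show ?thesis
    unfolding gutkin_small_def Let_def by eventually_elim blast
qed

text \<open>By compactness, angles that fail for \<epsilon> = 1 / (m + 1) would accumulate at an
  angle contradicting the limit statement. Uniformity matters because \<theta> is found only after
  \<epsilon>.\<close>

lemma gutkin_small_uniform:
  assumes "0 < a" "0 < \<delta>" "b + \<delta> < pi"
  obtains \<epsilon> where "\<epsilon> > 0" "\<And>\<theta>. a \<le> \<theta> \<Longrightarrow> \<theta> \<le> b \<Longrightarrow> gutkin_small \<delta> \<theta> \<epsilon>"
proof (rule ccontr)
  assume contra: "\<not> thesis"
  have "\<exists>\<theta>. a \<le> \<theta> \<and> \<theta> \<le> b \<and> \<not> gutkin_small \<delta> \<theta> (1 / real (Suc m))" for m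
    using contra that[of "1 / real (Suc m)"] by auto
  then obtain f where f: "\<And>m. f m \<in> {a..b}" "\<And>m. \<not> gutkin_small \<delta> (f m) (1 / real (Suc m))"
    by (metis atLeastAtMost_iff)
  then obtain l s where l: "l \<in> {a..b}" "strict_mono (s :: nat \<Rightarrow> nat)" "(f \<circ> s) \<longlonglongrightarrow> l"
    using compact_Icc[of a b] unfolding compact_def by metis
  have lim: "((\<lambda>m. 1 / real (Suc m)) \<circ> s) \<longlonglongrightarrow> 0"
    using LIMSEQ_subseq_LIMSEQ[OF LIMSEQ_Suc[OF lim_1_over_n] l(2)] by simp
  have "\<forall>\<^sub>F m in sequentially. gutkin_small \<delta> ((f \<circ> s) m) (((\<lambda>m. 1 / real (Suc m)) \<circ> s) m)"
    by (rule gutkin_small_tendsto[OF _ assms(2) _ l(3) lim]) (use l assms in auto)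
  then show False using f(2) by (auto simp: eventually_sequentially)
qed

lemma reduce_mod_2pi:
  fixes x :: real
  obtains v and m :: int where "x = v + 2 * pi * m" "\<bar>v\<bar> \<le> pi"
proof
  define m where "m = round (x / (2 * pi))"
  show "x = (x - 2 * pi * m) + 2 * pi * m" by simp
  have "\<bar>of_int m - x / (2 * pi)\<bar> * (2 * pi) \<le> 1 / 2 * (2 * pi)"
    unfolding m_def by (intro mult_right_mono of_int_round_abs_le) auto
  also have "\<bar>of_int m - x / (2 * pi)\<bar> * (2 * pi) = \<bar>(of_int m - x / (2 * pi)) * (2 * pi)\<bar>" by (simp add: abs_mult)
  also have "(of_int m - x / (2 * pi)) * (2 * pi) = 2 * pi * m - x" by (simp add: field_simps)
  finally show "\<bar>x - 2 * pi * m\<bar> \<le> pi" by simp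
qed

section \<open>The table built on a nearly circular curve of centres\<close>

locale near_circle =
  fixes G G' :: "real \<Rightarrow> complex" and \<delta> \<theta> \<epsilon> k c :: real
  assumes angles: "0 < \<theta>" "0 < \<delta>" "\<theta> + \<delta> < pi"
    and G_deriv: "\<And>t. (G has_vector_derivative G' t) (at t)"
    and periodic: "\<And>t. G (t + 2 * pi) = G t"
    and speed: "\<And>t. norm (G' t) = k"
    and chord: "\<And>t. norm (G (t + \<theta>) - G (t - \<theta>)) = c"
    and near: "\<And>t. norm (G t - cis t) \<le> \<epsilon>" "\<And>t. norm (G' t - \<i> * cis t) \<le> \<epsilon>"
    and small: "gutkin_small \<delta> \<theta> \<epsilon>"
begin

definition "R = sin (\<theta> + \<delta>) / sin \<delta>"
definition "e = \<epsilon> / sin \<delta>"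
definition "d = 4 * \<epsilon> / sin \<theta>"
definition "r = c / (2 * sin \<delta>)"

text \<open>Midpoint of the chord, moved along its normal: solving for \<open>\<gamma>\<close> the two conditions that
  the centres \<open>\<gamma> + \<i> r cis (\<plusminus>\<delta>) T\<close> are the end points of the chord, with \<open>T\<close> along the chord.\<close>

definition table :: "real \<Rightarrow> complex" where
  "table t = (cis \<delta> * G (t + \<theta>) - cis (- \<delta>) * G (t - \<theta>)) / (2 * \<i> * of_real (sin \<delta>))"

definition table' :: "real \<Rightarrow> complex" where
  "table' t = (cis \<delta> * G' (t + \<theta>) - cis (- \<delta>) * G' (t - \<theta>)) / (2 * \<i> * of_real (sin \<delta>))"

definition tangent :: "real \<Rightarrow> complex" where
  "tangent t = (G (t + \<theta>) - G (t - \<theta>)) / of_real c"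

lemma sin_pos: "0 < sin \<theta>" "0 < sin \<delta>" "0 < sin (\<theta> + \<delta>)"
  using angles by (auto intro!: sin_gt_zero)

lemma \<epsilon>_nonneg: "0 \<le> \<epsilon>"
  using near(1)[of 0] norm_ge_zero order_trans by blast

text \<open>In this order the inequalities serve to show that the chord is longer than sin \<theta>
  and its end velocities differ, that the table moves forward along its tangent, that it is
  injective and winds around 0, that a Larmor circle meets it only twice (two inequalities), that
  the arc turns by more than \<pi> - \<theta> - \<delta> and less than 2 \<pi> (two inequalities),
  and that the arc enters a disc inside the table.\<close>

lemma smallD:
  "\<epsilon> < sin \<theta> / 2" "e + R * d < R" "e < R / 4"
  "2 * (R * (e + \<epsilon>) + (R + 1) * e) + 2 * e * (e + \<epsilon>) < R * sin (\<theta> / 2) / 2"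
  "2 * (R * (e + \<epsilon>) + (R + 1) * e) + 2 * e * (e + \<epsilon>) < R * cos (\<theta> / 2) / 2"
  "8 * d < pi - \<theta> - \<delta>" "8 * d < 2 * (\<theta> + \<delta>)"
  "\<bar>1 - sin \<theta> / sin \<delta>\<bar> + e + \<epsilon> + (sin \<theta> / sin \<delta> + e) * d + e < R"
  using small unfolding gutkin_small_def Let_def R_def e_def d_def by auto

lemma pos: "0 < R" "0 \<le> e" "0 \<le> d"
  using sin_pos \<epsilon>_nonneg by (auto simp: R_def e_def d_def)

lemma cis_chord: "cis (t + a) - cis (t - a) = 2 * \<i> * of_real (sin a) * cis t"
  by (simp add: complex_eq_iff cos_add cos_diff sin_add sin_diff)

lemma cis_table: "cis \<delta> * cis (t + \<theta>) - cis (- \<delta>) * cis (t - \<theta>) = 2 * \<i> * of_real (sin (\<theta> + \<delta>)) * cis t"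
  using cis_chord[of t "\<theta> + \<delta>"] by (simp add: cis_mult algebra_simps)

lemma chord_near: "norm (G (t + \<theta>) - G (t - \<theta>) - 2 * \<i> * of_real (sin \<theta>) * cis t) \<le> 2 * \<epsilon>"
  using norm_triangle_ineq4[of "G (t + \<theta>) - cis (t + \<theta>)" "G (t - \<theta>) - cis (t - \<theta>)"]
    near(1)[of "t + \<theta>"] near(1)[of "t - \<theta>"] cis_chord[of t \<theta>]
  by (simp add: algebra_simps)

lemma c_near: "\<bar>c - 2 * sin \<theta>\<bar> \<le> 2 * \<epsilon>"
proof -
  have "norm (2 * \<i> * of_real (sin \<theta>) * cis 0) = 2 * sin \<theta>" using sin_pos by (simp add: norm_mult)
  then show ?thesis
    using norm_triangle_ineq3[of "G (0 + \<theta>) - G (0 - \<theta>)" "2 * \<i> * of_real (sin \<theta>) * cis 0"]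
      chord_near[of 0] chord[of 0] by simp
qed

lemma c_ge: "sin \<theta> < c" and c_pos: "0 < c"
  using c_near smallD(1) sin_pos(1) by (auto simp: abs_le_iff)

lemma r_pos: "0 < r" and r_near: "\<bar>r - sin \<theta> / sin \<delta>\<bar> \<le> e"
proof -
  show "0 < r" using c_pos sin_pos by (simp add: r_def)
  have "r - sin \<theta> / sin \<delta> = (c - 2 * sin \<theta>) / (2 * sin \<delta>)"
    using sin_pos by (simp add: r_def field_simps)
  then have "\<bar>r - sin \<theta> / sin \<delta>\<bar> = \<bar>c - 2 * sin \<theta>\<bar> / (2 * sin \<delta>)" using sin_pos by (simp add: abs_divide abs_mult)
  also have "\<dots> \<le> 2 * \<epsilon> / (2 * sin \<delta>)" using c_near sin_pos by (intro divide_right_mono) auto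
  finally show "\<bar>r - sin \<theta> / sin \<delta>\<bar> \<le> e" by (simp add: e_def)
qed

lemma norm_tangent: "norm (tangent t) = 1"
  using chord[of t] c_pos by (simp add: tangent_def norm_divide)

lemma tangent_near: "norm (tangent t - \<i> * cis t) \<le> d"
proof -
  have "tangent t - \<i> * cis t
      = ((G (t + \<theta>) - G (t - \<theta>) - 2 * \<i> * of_real (sin \<theta>) * cis t) + of_real (2 * sin \<theta> - c) * (\<i> * cis t)) / of_real c"
    using c_pos by (simp add: tangent_def field_simps)
  also have "norm \<dots> \<le> (2 * \<epsilon> + 2 * \<epsilon>) / c"
  proof -
    have "norm (of_real (2 * sin \<theta> - c) * (\<i> * cis t)) \<le> 2 * \<epsilon>"
      unfolding norm_mult norm_of_real using c_near by simp
    from norm_triangle_mono[OF chord_near[of t] this] show ?thesis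
      unfolding norm_divide using c_pos by (simp add: divide_right_mono)
  qed
  also have "\<dots> \<le> (2 * \<epsilon> + 2 * \<epsilon>) / sin \<theta>"
    using c_ge c_pos sin_pos \<epsilon>_nonneg by (intro divide_left_mono) auto
  finally show ?thesis by (simp add: d_def)
qed

lemma norm_half_sum_le:
  assumes "norm u \<le> \<epsilon>" "norm v \<le> \<epsilon>"
  shows "norm ((cis \<delta> * u - cis (- \<delta>) * v) / (2 * \<i> * of_real (sin \<delta>))) \<le> e"
proof -
  have "norm (cis \<delta> * u - cis (- \<delta>) * v) \<le> 2 * \<epsilon>"
    using norm_triangle_ineq4[of "cis \<delta> * u" "cis (- \<delta>) * v"] assms by (simp add: norm_mult)
  then have "norm (cis \<delta> * u - cis (- \<delta>) * v) / (2 * sin \<delta>) \<le> 2 * \<epsilon> / (2 * sin \<delta>)"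
    using sin_pos by (intro divide_right_mono) auto
  then show ?thesis using sin_pos by (simp add: norm_divide norm_mult e_def)
qed

lemma table_near: "norm (table t - of_real R * cis t) \<le> e"
proof -
  have "of_real R * cis t = (cis \<delta> * cis (t + \<theta>) - cis (- \<delta>) * cis (t - \<theta>)) / (2 * \<i> * of_real (sin \<delta>))"
    unfolding cis_table R_def by simp
  moreover have "(cis \<delta> * G (t + \<theta>) - cis (- \<delta>) * G (t - \<theta>)) - (cis \<delta> * cis (t + \<theta>) - cis (- \<delta>) * cis (t - \<theta>))
      = cis \<delta> * (G (t + \<theta>) - cis (t + \<theta>)) - cis (- \<delta>) * (G (t - \<theta>) - cis (t - \<theta>))"
    by (simp only: right_diff_distrib) simp
  ultimately have "table t - of_real R * cis t
      = (cis \<delta> * (G (t + \<theta>) - cis (t + \<theta>)) - cis (- \<delta>) * (G (t - \<theta>) - cis (t - \<theta>))) / (2 * \<i> * of_real (sin \<delta>))"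
    by (simp only: table_def diff_divide_distrib[symmetric])
  then show ?thesis using norm_half_sum_le[OF near(1) near(1)] by simp
qed

lemma table'_near: "norm (table' t - \<i> * of_real R * cis t) \<le> e"
proof -
  have "\<i> * of_real R * cis t = \<i> * ((cis \<delta> * cis (t + \<theta>) - cis (- \<delta>) * cis (t - \<theta>)) / (2 * \<i> * of_real (sin \<delta>)))"
    unfolding cis_table R_def by simp
  also have "\<dots> = (cis \<delta> * (\<i> * cis (t + \<theta>)) - cis (- \<delta>) * (\<i> * cis (t - \<theta>))) / (2 * \<i> * of_real (sin \<delta>))"
    by (simp only: times_divide_eq_right right_diff_distrib mult_ac)
  also have "table' t - \<dots> = ((cis \<delta> * G' (t + \<theta>) - cis (- \<delta>) * G' (t - \<theta>))
      - (cis \<delta> * (\<i> * cis (t + \<theta>)) - cis (- \<delta>) * (\<i> * cis (t - \<theta>)))) / (2 * \<i> * of_real (sin \<delta>))"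
    by (simp only: table'_def diff_divide_distrib[symmetric])
  also have "(cis \<delta> * G' (t + \<theta>) - cis (- \<delta>) * G' (t - \<theta>))
      - (cis \<delta> * (\<i> * cis (t + \<theta>)) - cis (- \<delta>) * (\<i> * cis (t - \<theta>)))
      = cis \<delta> * (G' (t + \<theta>) - \<i> * cis (t + \<theta>)) - cis (- \<delta>) * (G' (t - \<theta>) - \<i> * cis (t - \<theta>))"
    by (simp only: right_diff_distrib) simp
  finally have "table' t - \<i> * of_real R * cis t
      = (cis \<delta> * (G' (t + \<theta>) - \<i> * cis (t + \<theta>)) - cis (- \<delta>) * (G' (t - \<theta>) - \<i> * cis (t - \<theta>))) / (2 * \<i> * of_real (sin \<delta>))"
    .
  then show ?thesis using norm_half_sum_le[OF near(2) near(2)] by simp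
qed

lemma G_deriv_shift: "((\<lambda>t. G (t + a)) has_vector_derivative G' (t + a)) (at t)"
proof -
  have "((\<lambda>t. t + a) has_vector_derivative 1) (at t)"
    by (auto intro!: derivative_eq_intros simp: has_real_derivative_iff_has_vector_derivative[symmetric])
  from vector_diff_chain_at[OF this G_deriv] show ?thesis by (simp add: o_def)
qed

lemma table_deriv: "(table has_vector_derivative table' t) (at t)"
proof -
  have "((\<lambda>t. (cis \<delta> * G (t + \<theta>) - cis (- \<delta>) * G (t + - \<theta>)) * inverse (2 * \<i> * of_real (sin \<delta>)))
      has_vector_derivative (cis \<delta> * G' (t + \<theta>) - cis (- \<delta>) * G' (t + - \<theta>)) * inverse (2 * \<i> * of_real (sin \<delta>))) (at t)"
    by (intro has_vector_derivative_mult_left has_vector_derivative_diff has_vector_derivative_mult_right G_deriv_shift)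
  then show ?thesis
    unfolding table_def[abs_def] table'_def divide_inverse add_uminus_conv_diff .
qed

lemma table_periodic: "table (t + 2 * pi) = table t"
  using periodic[of "t + \<theta>"] periodic[of "t - \<theta>"] by (simp add: table_def algebra_simps)

text \<open>Since the chord has constant length, the two end velocities have the same component along
  it; having also the same length, they are mirror images in the chord.\<close>

lemma table'_tangent:
  obtains l where "0 < l" "table' t = of_real l * tangent t"
proof -
  define D D' w where "D = G (t + \<theta>) - G (t - \<theta>)" and "D' = G' (t + \<theta>) - G' (t - \<theta>)" and "w = tangent t"
  have "((\<lambda>t. G (t + \<theta>) - G (t + - \<theta>)) has_vector_derivative G' (t + \<theta>) - G' (t + - \<theta>)) (at t)"
    by (intro has_vector_derivative_diff G_deriv_shift)
  then have DD: "((\<lambda>t. G (t + \<theta>) - G (t - \<theta>)) has_vector_derivative D') (at t)" by (simp add: D'_def)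
  have "((\<lambda>t. (G (t + \<theta>) - G (t - \<theta>)) \<bullet> (G (t + \<theta>) - G (t - \<theta>))) has_real_derivative D \<bullet> D' + D' \<bullet> D) (at t)"
    using bounded_bilinear.has_vector_derivative[OF bounded_bilinear_inner DD DD]
    by (simp add: has_real_derivative_iff_has_vector_derivative D_def)
  moreover have "(\<lambda>t. (G (t + \<theta>) - G (t - \<theta>)) \<bullet> (G (t + \<theta>) - G (t - \<theta>))) = (\<lambda>t. c\<^sup>2)"
    by (simp add: power2_norm_eq_inner[symmetric] chord)
  ultimately have "D \<bullet> D' + D' \<bullet> D = 0"
    using DERIV_unique[OF _ DERIV_const[of "c\<^sup>2"]] by metis
  then have "D' \<bullet> D = 0" by (simp add: inner_commute)
  moreover have w: "D = of_real c * w" using c_pos by (simp add: D_def w_def tangent_def)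
  ultimately have orth: "Re (D' * cnj w) = 0"
    using c_pos by (simp add: inner_complex_def algebra_simps) (metis distrib_left mult.commute mult_eq_0_iff order_less_irrefl)
  have ww: "w * cnj w = 1" "cnj w * w = 1" using norm_tangent[of t] by (simp_all add: w_def complex_norm_square[symmetric] mult.commute)
  have nw: "norm w = 1" by (simp add: w_def norm_tangent)
  define a b where "a = G' (t + \<theta>) * cnj w" and "b = G' (t - \<theta>) * cnj w"
  have ab: "D' * cnj w = a - b" by (simp add: a_def b_def D'_def algebra_simps)
  \<comment> \<open>Equal end velocities are excluded: on the unit circle they differ by 2 sin
    \<theta>, more than the total error 2 \<epsilon>.\<close>
  have "a \<noteq> b"
  proof
    assume "a = b"
    then have "D' = 0" using ab nw by auto
    have "\<i> * cis (t + \<theta>) - \<i> * cis (t - \<theta>) = \<i> * (2 * \<i> * of_real (sin \<theta>) * cis t)"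
      by (simp only: cis_chord[symmetric] right_diff_distrib)
    then have "norm (\<i> * cis (t + \<theta>) - \<i> * cis (t - \<theta>)) = 2 * sin \<theta>" using sin_pos by (simp add: norm_mult)
    moreover have "(G' (t - \<theta>) - \<i> * cis (t - \<theta>)) - (G' (t + \<theta>) - \<i> * cis (t + \<theta>)) = \<i> * cis (t + \<theta>) - \<i> * cis (t - \<theta>)"
      using \<open>D' = 0\<close> by (simp add: D'_def)
    ultimately have "2 * sin \<theta> \<le> 2 * \<epsilon>"
      using norm_triangle_ineq4[of "G' (t - \<theta>) - \<i> * cis (t - \<theta>)" "G' (t + \<theta>) - \<i> * cis (t + \<theta>)"]
        near(2)[of "t - \<theta>"] near(2)[of "t + \<theta>"] by simp
    then show False using smallD(1) sin_pos by simp
  qed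
  have "norm a = norm b" by (simp add: a_def b_def norm_mult speed)
  then have "(Re a)\<^sup>2 + (Im a)\<^sup>2 = (Re b)\<^sup>2 + (Im b)\<^sup>2" by (simp add: cmod_def)
  moreover have re: "Re a = Re b" using orth ab by simp
  ultimately have "Im a = Im b \<or> Im a = - Im b" by (simp add: power2_eq_iff)
  then have b: "b = cnj a" using \<open>a \<noteq> b\<close> re by (auto simp: complex_eq_iff)
  define l where "l = Im (cis \<delta> * a) / sin \<delta>"
  have "table' t * cnj w = (cis \<delta> * a - cis (- \<delta>) * b) / (2 * \<i> * of_real (sin \<delta>))"
    by (simp add: table'_def a_def b_def algebra_simps)
  also have "cis \<delta> * a - cis (- \<delta>) * b = 2 * \<i> * of_real (Im (cis \<delta> * a))"
    by (simp add: b complex_eq_iff)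
  finally have l: "table' t * cnj w = of_real l" using sin_pos by (simp add: l_def)
  \<comment> \<open>Only the sign of \<open>l\<close> is left. On the circle its value is R, and the
    perturbation is smaller than R.\<close>
  have "table' t * cnj w - of_real R
      = (table' t - \<i> * of_real R * cis t) * cnj w + of_real R * (\<i> * cis t - w) * cnj w"
    using ww by (simp add: algebra_simps)
  also have "norm \<dots> \<le> norm (table' t - \<i> * of_real R * cis t) + R * norm (\<i> * cis t - w)"
    using pos nw by (intro order_trans[OF norm_triangle_ineq]) (simp add: norm_mult)
  also have "\<dots> \<le> e + R * d"
    using table'_near tangent_near[of t] pos by (intro add_mono mult_left_mono) (auto simp: w_def norm_minus_commute)
  finally have "norm (complex_of_real l - of_real R) \<le> e + R * d" by (simp only: l)
  then have "\<bar>l - R\<bar> \<le> e + R * d" by (metis norm_of_real of_real_diff)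
  then have "0 < l" using smallD(2) by linarith
  moreover have "table' t = of_real l * w" using l ww by (metis mult.assoc mult.right_neutral)
  ultimately show ?thesis using that w_def by blast
qed

text \<open>The arc leaving at parameter t is centred at \<open>G (t - \<theta>)\<close>, the arc
  returning at parameter t at \<open>G (t + \<theta>)\<close>. So an arc that leaves at t should
  return at t - 2 \<theta>.\<close>

lemma table_centre:
  "table t + \<i> * of_real r * cis \<delta> * tangent t = G (t - \<theta>)"
  "table t + \<i> * of_real r * cis (- \<delta>) * tangent t = G (t + \<theta>)"
proof -
  let ?s = "of_real (sin \<delta>) :: complex"
  have s: "?s \<noteq> 0" using sin_pos by simp
  have i: "\<i> * of_real r * x * tangent t = - (x * (G (t + \<theta>) - G (t - \<theta>))) / (2 * \<i> * ?s)" for x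
  proof -
    have "\<i> * of_real r * x * tangent t = \<i> * (x * (G (t + \<theta>) - G (t - \<theta>))) / (2 * ?s)"
      using c_pos by (simp add: r_def tangent_def)
    also have "\<dots> = - (x * (G (t + \<theta>) - G (t - \<theta>))) / (2 * \<i> * ?s)"
      using s by (simp add: field_simps)
    finally show ?thesis .
  qed
  have cc: "cis \<delta> - cis (- \<delta>) = 2 * \<i> * ?s" by (simp add: complex_eq_iff)
  have "table t + \<i> * of_real r * cis \<delta> * tangent t = (cis \<delta> - cis (- \<delta>)) * G (t - \<theta>) / (2 * \<i> * ?s)"
    unfolding i table_def by (simp add: add_divide_distrib[symmetric] algebra_simps)
  then show "table t + \<i> * of_real r * cis \<delta> * tangent t = G (t - \<theta>)" using s unfolding cc by simp
  have "table t + \<i> * of_real r * cis (- \<delta>) * tangent t = (cis \<delta> - cis (- \<delta>)) * G (t + \<theta>) / (2 * \<i> * ?s)"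
    unfolding i table_def by (simp add: add_divide_distrib[symmetric] algebra_simps)
  then show "table t + \<i> * of_real r * cis (- \<delta>) * tangent t = G (t + \<theta>)" using s unfolding cc by simp
qed

text \<open>Mean value inequality for the deviation from the circle. A bound proportional to \<bar>s
  - t\<bar>, rather than the constant e, is what allows parameters to be proved equal and not merely
  close.\<close>

lemma table_lipschitz:
  "norm ((table s - of_real R * cis s) - (table t - of_real R * cis t)) \<le> e * \<bar>s - t\<bar>"
proof -
  have cisd: "(cis has_vector_derivative \<i> * cis x) (at x)" for x
    unfolding cis_conv_exp[abs_def]
    by (rule has_vector_derivative_real_field) (auto intro!: derivative_eq_intros)
  let ?f' = "\<lambda>x. table' x - \<i> * of_real R * cis x"
  have "((\<lambda>t. table t - of_real R * cis t) has_vector_derivative table' x - of_real R * (\<i> * cis x)) (at x)" for x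
    by (intro has_vector_derivative_diff table_deriv has_vector_derivative_mult_right cisd)
  then have "((\<lambda>t. table t - of_real R * cis t) has_derivative (\<lambda>h. h *\<^sub>R ?f' x)) (at x within UNIV)" for x
    by (simp add: has_vector_derivative_def mult_ac)
  moreover have "onorm (\<lambda>h. h *\<^sub>R ?f' x) \<le> e" for x
    by (rule onorm_bound) (use pos table'_near[of x] in \<open>auto simp: mult.commute intro: mult_left_mono\<close>)
  ultimately show ?thesis
    using differentiable_bound[of UNIV "\<lambda>t. table t - of_real R * cis t" "\<lambda>x h. h *\<^sub>R ?f' x" e s t] by simp
qed

text \<open>The circle of radius R has chords of length at least R \<bar>s - t\<bar> / 4; the
  deviation takes away at most e \<bar>s - t\<bar>, and e < R / 4.\<close>

lemma table_inj:
  assumes "table s = table t" "\<bar>s - t\<bar> \<le> pi"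
  shows "s = t"
proof -
  have "R * norm (cis s - cis t) = norm ((table s - of_real R * cis s) - (table t - of_real R * cis t))"
    using assms(1) pos by (simp add: norm_minus_commute norm_mult[symmetric] right_diff_distrib[symmetric] flip: norm_of_real)
       (simp add: norm_mult norm_minus_commute)?
  then have "R * norm (cis s - cis t) \<le> e * \<bar>s - t\<bar>" using table_lipschitz[of s t] by simp
  moreover have "R * (\<bar>s - t\<bar> / 4) \<le> R * norm (cis s - cis t)"
    using norm_cis_diff_ge[OF assms(2)] pos by (intro mult_left_mono) auto
  ultimately have "(R / 4 - e) * \<bar>s - t\<bar> \<le> 0" by (simp add: algebra_simps)
  then show ?thesis using smallD(3) by (simp add: mult_le_0_iff)
qed

lemma table_periodic_int: "table (t + 2 * pi * of_int m) = table t"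
proof (induction m rule: int_induct[where k = 0])
  case (step1 i)
  then show ?case using table_periodic[of "t + 2 * pi * of_int i"] by (simp add: algebra_simps)
next
  case (step2 i)
  then show ?case using table_periodic[of "t + 2 * pi * of_int (i - 1)"] by (simp add: algebra_simps)
qed simp

lemma table_eqD:
  assumes "table s = table t"
  obtains m :: int where "s = t + 2 * pi * m"
proof -
  obtain v and m :: int where vm: "s - t = v + 2 * pi * m" "\<bar>v\<bar> \<le> pi" using reduce_mod_2pi by blast
  then have "s = (t + v) + 2 * pi * m" by simp
  then have "table (t + v) = table t" using assms table_periodic_int by metis
  then have "t + v = t" using table_inj vm(2) by (metis add_diff_cancel_left')
  then have "s = t + 2 * pi * m" using vm(1) by simp
  then show ?thesis by (rule that)
qed

text \<open>Without perturbation the squared distance between the points at \<tau> + x and the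
  centre is R^2 + 1 - 2 R cos x. For equal true distances the cosines differ only by error terms,
  and each of these contains a difference between parameters v and u, hence a factor \<bar>v -
  u\<bar>.\<close>

lemma circle_meets_table_aux:
  assumes "norm (table (\<tau> + v) - G \<tau>) = r" "norm (table (\<tau> + u) - G \<tau>) = r"
  shows "2 * R * \<bar>cos u - cos v\<bar> \<le> (2 * (R * (e + \<epsilon>) + (R + 1) * e) + 2 * e * (e + \<epsilon>)) * \<bar>v - u\<bar>"
proof -
  define z where "z x = of_real R * cis (\<tau> + x) - cis \<tau>" for x
  define w where "w x = (table (\<tau> + x) - of_real R * cis (\<tau> + x)) - (G \<tau> - cis \<tau>)" for x
  have zw: "table (\<tau> + x) - G \<tau> = z x + w x" for x by (simp add: z_def w_def)
  have nz2: "z x \<bullet> z x = R\<^sup>2 + 1 - 2 * R * cos x" for x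
  proof -
    have "z x = cis \<tau> * (of_real R * cis x - 1)" by (simp add: z_def cis_mult[symmetric] algebra_simps)
    then have "z x \<bullet> z x = (norm (of_real R * cis x - 1))\<^sup>2"
      by (simp add: power2_norm_eq_inner[symmetric] norm_mult)
    also have "\<dots> = (R * cos x - 1)\<^sup>2 + (R * sin x)\<^sup>2" by (simp add: cmod_power2)
    also have "\<dots> = R\<^sup>2 * ((sin x)\<^sup>2 + (cos x)\<^sup>2) + 1 - 2 * R * cos x"
      by algebra
    finally show ?thesis by simp
  qed
  have nz: "norm (z x) \<le> R + 1" for x
    using norm_triangle_ineq4[of "of_real R * cis (\<tau> + x)" "cis \<tau>"] pos by (simp add: z_def norm_mult)
  have nw: "norm (w x) \<le> e + \<epsilon>" for x
    using norm_triangle_ineq4[of "table (\<tau> + x) - of_real R * cis (\<tau> + x)" "G \<tau> - cis \<tau>"]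
      table_near[of "\<tau> + x"] near(1)[of \<tau>] by (simp add: w_def)
  have dz: "norm (z v - z u) \<le> R * \<bar>v - u\<bar>"
  proof -
    have "z v - z u = of_real R * (cis (\<tau> + v) - cis (\<tau> + u))" by (simp add: z_def algebra_simps)
    then show ?thesis using norm_cis_diff_le[of "\<tau> + v" "\<tau> + u"] pos by (simp add: norm_mult)
  qed
  have dw: "norm (w v - w u) \<le> e * \<bar>v - u\<bar>"
  proof -
    have "w v - w u = (table (\<tau> + v) - of_real R * cis (\<tau> + v)) - (table (\<tau> + u) - of_real R * cis (\<tau> + u))"
      by (simp add: w_def algebra_simps)
    then show ?thesis using table_lipschitz[of "\<tau> + v" "\<tau> + u"] by (simp only: add_diff_cancel_left)
  qed
  have "(z v + w v) \<bullet> (z v + w v) = (z u + w u) \<bullet> (z u + w u)"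
    using assms by (simp add: zw power2_norm_eq_inner[symmetric])
  then have "2 * R * (cos u - cos v)
      = - (2 * ((z v - z u) \<bullet> w v) + 2 * (z u \<bullet> (w v - w u)) + (w v - w u) \<bullet> (w v + w u))"
    using nz2[of u] nz2[of v]
    by (simp add: inner_add_left inner_add_right inner_diff_left inner_diff_right inner_commute algebra_simps)
  then have "\<bar>2 * R * (cos u - cos v)\<bar>
      = \<bar>2 * ((z v - z u) \<bullet> w v) + 2 * (z u \<bullet> (w v - w u)) + (w v - w u) \<bullet> (w v + w u)\<bar>"
    by (simp only: abs_minus_cancel)
  also have "\<dots> \<le> 2 * \<bar>(z v - z u) \<bullet> w v\<bar> + 2 * \<bar>z u \<bullet> (w v - w u)\<bar> + \<bar>(w v - w u) \<bullet> (w v + w u)\<bar>"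
    by linarith
  also have "\<dots> \<le> 2 * ((R * \<bar>v - u\<bar>) * (e + \<epsilon>)) + 2 * ((R + 1) * (e * \<bar>v - u\<bar>)) + (e * \<bar>v - u\<bar>) * (2 * (e + \<epsilon>))"
  proof (intro add_mono mult_left_mono)
    have cs: "\<bar>a \<bullet> b\<bar> \<le> A * B" if "norm a \<le> A" "norm b \<le> B" for a b :: complex and A B
    proof (rule order_trans[OF Cauchy_Schwarz_ineq2 mult_mono[OF that]])
      show "0 \<le> A" using that(1) norm_ge_zero[of a] by linarith
    qed simp
    show "\<bar>(z v - z u) \<bullet> w v\<bar> \<le> R * \<bar>v - u\<bar> * (e + \<epsilon>)" by (rule cs[OF dz nw])
    show "\<bar>z u \<bullet> (w v - w u)\<bar> \<le> (R + 1) * (e * \<bar>v - u\<bar>)" by (rule cs[OF nz dw])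
    have "norm (w v + w u) \<le> 2 * (e + \<epsilon>)"
      by (rule order_trans[OF norm_triangle_ineq order_trans[OF add_mono[OF nw nw]]]) simp
    then show "\<bar>(w v - w u) \<bullet> (w v + w u)\<bar> \<le> e * \<bar>v - u\<bar> * (2 * (e + \<epsilon>))" by (rule cs[OF dw])
  qed auto
  also have "\<bar>2 * R * (cos u - cos v)\<bar> = 2 * R * \<bar>cos u - cos v\<bar>" using pos by (simp add: abs_mult)
  finally show ?thesis by (simp add: algebra_simps)
qed

lemma norm_table_centre: "norm (table (\<tau> + \<theta>) - G \<tau>) = r" "norm (table (\<tau> - \<theta>) - G \<tau>) = r"
proof -
  have "table (\<tau> + \<theta>) - G \<tau> = - (\<i> * of_real r * cis \<delta> * tangent (\<tau> + \<theta>))"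
    "table (\<tau> - \<theta>) - G \<tau> = - (\<i> * of_real r * cis (- \<delta>) * tangent (\<tau> - \<theta>))"
    using table_centre(1)[of "\<tau> + \<theta>"] table_centre(2)[of "\<tau> - \<theta>"] by (simp_all add: algebra_simps)
  then show "norm (table (\<tau> + \<theta>) - G \<tau>) = r" "norm (table (\<tau> - \<theta>) - G \<tau>) = r"
    using r_pos norm_tangent by (simp_all add: norm_mult)
qed

text \<open>The solutions \<theta> and -\<theta> are known. Since cos \<theta> - cos u is a product
  of sines, it grows linearly in \<bar>u - \<theta>\<bar> and faster than the error, which excludes
  others. The factor sin ((\<theta> + u) / 2) has its argument between \<theta> / 2 and (\<theta> +
  \<pi>) / 2, so it is at least sin (\<theta> / 2) or cos (\<theta> / 2).\<close>

lemma circle_meets_table: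
  assumes v: "\<bar>v\<bar> \<le> pi" and meet: "norm (table (\<tau> + v) - G \<tau>) = r"
  shows "v = \<theta> \<or> v = - \<theta>"
proof -
  define L where "L = 2 * (R * (e + \<epsilon>) + (R + 1) * e) + 2 * e * (e + \<epsilon>)"
  define u where "u = \<bar>v\<bar>"
  have u: "0 \<le> u" "u \<le> pi" using v by (auto simp: u_def)
  have key: "2 * R * \<bar>cos \<theta> - cos u\<bar> \<le> L * \<bar>u - \<theta>\<bar>"
  proof (cases "0 \<le> v")
    case True
    then show ?thesis
      using circle_meets_table_aux[OF meet norm_table_centre(1)] by (simp add: L_def u_def)
  next
    case False
    then have "\<bar>v - - \<theta>\<bar> = \<bar>u - \<theta>\<bar>" "cos u = cos v" by (auto simp: u_def)
    then show ?thesis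
      using circle_meets_table_aux[OF meet, of "- \<theta>"] norm_table_centre(2) by (simp add: L_def)
  qed
  let ?x = "(\<theta> + u) / 2"
  have x: "L < R * sin ?x / 2"
  proof (cases "?x \<le> pi / 2")
    case True
    have "sin (\<theta> / 2) \<le> sin ?x" using True u angles by (intro sin_monotone_2pi_le) auto
    then have "R * sin (\<theta> / 2) / 2 \<le> R * sin ?x / 2" using pos by simp
    then show ?thesis using smallD(4) by (simp add: L_def)
  next
    case False
    have "- (pi / 2) \<le> pi / 2 - \<theta> / 2" "pi / 2 - \<theta> / 2 \<le> pi - ?x" "pi - ?x \<le> pi / 2"
      using False u angles by (simp_all add: field_simps)
    then have "sin (pi / 2 - \<theta> / 2) \<le> sin (pi - ?x)" by (rule sin_monotone_2pi_le)
    then have "cos (\<theta> / 2) \<le> sin ?x" by (simp add: sin_diff)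
    then have "R * cos (\<theta> / 2) / 2 \<le> R * sin ?x / 2" using pos by simp
    then show ?thesis using smallD(5) by (simp add: L_def)
  qed
  have s0: "0 \<le> sin ?x" using u angles by (intro sin_ge_zero) auto
  have "\<bar>(u - \<theta>) / 2\<bar> / 4 \<le> \<bar>sin ((u - \<theta>) / 2)\<bar>"
    using u angles by (intro abs_sin_ge) (auto simp: abs_le_iff)
  then have "2 * R * (2 * sin ?x * (\<bar>u - \<theta>\<bar> / 8)) \<le> 2 * R * (2 * sin ?x * \<bar>sin ((u - \<theta>) / 2)\<bar>)"
    using pos s0 by (intro mult_left_mono) auto
  also have "2 * sin ?x * \<bar>sin ((u - \<theta>) / 2)\<bar> = \<bar>cos \<theta> - cos u\<bar>"
    unfolding cos_diff_cos using s0 by (simp add: abs_mult)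
  finally have "(R * sin ?x / 2 - L) * \<bar>u - \<theta>\<bar> \<le> 0" using key by (simp add: algebra_simps)
  then have "u = \<theta>" using x by (simp add: mult_le_0_iff)
  then show ?thesis by (auto simp: u_def abs_if split: if_splits)
qed

section \<open>The table as a positively oriented Jordan curve\<close>

definition curve :: "real \<Rightarrow> complex" where "curve s = table (2 * pi * s)"

lemma curve_deriv: "(curve has_vector_derivative of_real (2 * pi) * table' (2 * pi * s)) (at s)"
proof -
  have "((\<lambda>s. 2 * pi * s) has_vector_derivative 2 * pi) (at s)"
    by (auto intro!: derivative_eq_intros simp: has_real_derivative_iff_has_vector_derivative[symmetric])
  from vector_diff_chain_at[OF this table_deriv] show ?thesis
    by (simp add: o_def curve_def[abs_def] scaleR_conv_of_real)
qed

lemma curve_unit_tangent: "vd curve s \<noteq> 0" "unit_tangent curve s = tangent (2 * pi * s)"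
proof -
  obtain l where l: "0 < l" "table' (2 * pi * s) = of_real l * tangent (2 * pi * s)"
    using table'_tangent by blast
  then have v: "vd curve s = of_real (2 * pi * l) * tangent (2 * pi * s)"
    unfolding vd_def using vector_derivative_at[OF curve_deriv[of s]] by simp
  then have n: "norm (vd curve s) = 2 * pi * l" using l norm_tangent by (simp add: norm_mult)
  then show "vd curve s \<noteq> 0" using l by auto
  show "unit_tangent curve s = tangent (2 * pi * s)" 
    unfolding unit_tangent_def n using l by (simp add: v)
qed

lemma curve_periodic: "curve (t + 1) = curve t"
  using table_periodic[of "2 * pi * t"] by (simp add: curve_def algebra_simps)

lemma curve_eqD:
  assumes "curve s = curve t"
  obtains m :: int where "s = t + m"
proof -
  obtain m :: int where "2 * pi * s = 2 * pi * t + 2 * pi * m"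
    using table_eqD assms unfolding curve_def by blast
  then have "2 * pi * s = 2 * pi * (t + m)" by (simp add: algebra_simps)
  then show ?thesis using that[of m] by simp
qed

lemma curve_inj: "inj_on curve {0..<1}"
proof (rule inj_onI)
  fix s t :: real assume st: "s \<in> {0..<1}" "t \<in> {0..<1}" "curve s = curve t"
  then obtain m :: int where m: "s = t + m" using curve_eqD by blast
  then have "\<bar>of_int m :: real\<bar> < 1" using st by auto
  then show "s = t" using m by simp
qed

lemma simple_path_curve: "simple_path curve"
proof -
  have "continuous_on UNIV curve"
    using curve_deriv has_vector_derivative_continuous continuous_at_imp_continuous_on by blast
  then have "path curve" unfolding path_def using continuous_on_subset by blast
  moreover have "loop_free curve"
    unfolding loop_free_def
  proof (intro ballI impI)
    fix s t :: real assume st: "s \<in> {0..1}" "t \<in> {0..1}" "curve s = curve t"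
    then obtain m :: int where m: "s = t + m" using curve_eqD by blast
    then have "\<bar>of_int m :: real\<bar> \<le> 1" using st by auto
    then have "m = 0 \<or> m = 1 \<or> m = -1" by linarith
    then show "s = t \<or> s = 0 \<and> t = 1 \<or> s = 1 \<and> t = 0" using m st by auto
  qed
  ultimately show ?thesis by (simp add: simple_path_def)
qed

lemma curve_closed: "pathfinish curve = pathstart curve"
  using curve_periodic[of 0] by (simp add: pathfinish_def pathstart_def)

lemma path_image_curve: "path_image curve = range table"
proof
  show "path_image curve \<subseteq> range table" by (auto simp: path_image_def curve_def)
  show "range table \<subseteq> path_image curve"
  proof clarify
    fix x :: real
    define m where "m = \<lfloor>x / (2 * pi)\<rfloor>"
    have "of_int m \<le> x / (2 * pi)" "x / (2 * pi) \<le> of_int m + 1" by (auto simp: m_def)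
    moreover have "table x = curve (x / (2 * pi) - m)"
      using table_periodic_int[of "x - 2 * pi * m" m] by (simp add: curve_def algebra_simps)
    ultimately show "table x \<in> path_image curve"
      unfolding path_image_def by (intro image_eqI[of _ _ "x / (2 * pi) - m"]) auto
  qed
qed

text \<open>The curve stays closer to the circle of radius R than that circle is to the origin, so
  the winding numbers agree.\<close>

lemma winding_number_curve_0: "winding_number curve 0 = 1"
proof -
  have "winding_number curve 0 = winding_number (circlepath 0 R) 0"
  proof (rule winding_number_nearby_loops_eq)
    show "path curve" using simple_path_curve simple_path_imp_path by blast
    fix t :: real
    have "circlepath 0 R t = of_real R * cis (2 * pi * t)" by (simp add: circlepath cis_conv_exp mult_ac)
    then have "norm (curve t - circlepath 0 R t) \<le> e" "norm (circlepath 0 R t - 0) = R"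
      using table_near[of "2 * pi * t"] pos by (simp_all add: curve_def norm_mult)
    then show "norm (curve t - circlepath 0 R t) < norm (circlepath 0 R t - 0)"
      using smallD(3) pos by linarith
  qed (auto simp: curve_closed)
  then show ?thesis using winding_number_circlepath_centre[OF pos(1), of 0] by simp
qed

lemma norm_table_ge: "R - e \<le> norm (table t)"
  using norm_triangle_ineq2[of "of_real R * cis t" "of_real R * cis t - table t"] table_near[of t] pos
  by (simp add: norm_mult norm_minus_commute)

lemma zero_inside: "0 \<in> inside (path_image curve)"
proof -
  have "table x \<noteq> 0" for x using norm_table_ge[of x] smallD(3) pos by auto
  then have "0 \<notin> path_image curve" by (metis path_image_curve rangeE)
  moreover have "0 \<notin> outside (path_image curve)"
    using winding_number_zero_in_outside[of curve 0] winding_number_curve_0 simple_path_curve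
      simple_path_imp_path curve_closed by fastforce
  ultimately show ?thesis using inside_Un_outside by blast
qed

text \<open>Inside a simple closed curve the winding number is 1 throughout or -1 throughout; the
  origin decides.\<close>

lemma winding_number_curve: "z \<in> inside (path_image curve) \<Longrightarrow> winding_number curve z = 1"
proof -
  assume z: "z \<in> inside (path_image curve)"
  show ?thesis
    by (rule simple_closed_path_winding_number_inside[OF simple_path_curve])
       (use z zero_inside winding_number_curve_0 in force)+
qed

lemma connected_inside_curve:
  assumes "connected S" "S \<inter> range table = {}" "x \<in> S" "x \<in> inside (path_image curve)"
  shows "S \<subseteq> inside (path_image curve)"
proof
  fix y assume "y \<in> S"
  then have "connected_component (- path_image curve) x y"
    unfolding connected_component_def using assms path_image_curve by (intro exI[of _ S]) auto
  then show "y \<in> inside (path_image curve)" using assms(4) inside_same_component by blast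
qed

lemma ball_inside: "ball 0 (R - e) \<subseteq> inside (path_image curve)"
proof (rule connected_inside_curve[of _ 0])
  have "table x \<notin> ball 0 (R - e)" for x using norm_table_ge[of x] by simp
  then show "ball 0 (R - e) \<inter> range table = {}" by blast
qed (use zero_inside smallD(3) pos in auto)

text \<open>The Larmor arc avoids the table in its interior and has a point near \<open>(1 - r) cis (t - \<theta>)\<close>,
  which is closer to the origin than the table.\<close>

lemma larmor_arc:
  obtains x1 where "0 < x1"
    "\<And>x. x \<in> {0<..<x1} \<Longrightarrow> larmor (1 / r) (table t) (cis \<delta> * tangent t) x \<in> inside (path_image curve)"
    "table (t - 2 * \<theta>) = larmor (1 / r) (table t) (cis \<delta> * tangent t) x1"
    "cis \<delta> * tangent t * cis (1 / r * x1) = cis (- \<delta>) * tangent (t - 2 * \<theta>)"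
proof -
  define v where "v = cis \<delta> * tangent t"
  define v1 where "v1 = cis (- \<delta>) * tangent (t - 2 * \<theta>)"
  have n: "norm v = 1" "norm v1 = 1" using norm_tangent by (auto simp: v_def v1_def norm_mult)
  then have v0: "v \<noteq> 0" by auto
  have rp: "r > 0" by (rule r_pos)
  have centre: "table t + \<i> * of_real r * v = G (t - \<theta>)" "table (t - 2 * \<theta>) + \<i> * of_real r * v1 = G (t - \<theta>)"
    using table_centre(1)[of t] table_centre(2)[of "t - 2 * \<theta>"] by (simp_all add: v_def v1_def mult_ac)
  have centre': "table t = G (t - \<theta>) - \<i> * of_real r * v" "table (t - 2 * \<theta>) = G (t - \<theta>) - \<i> * of_real r * v1"
    using centre by (simp_all only: eq_diff_eq)
  have arc: "larmor (1 / r) (table t) v x = G (t - \<theta>) - \<i> * of_real r * v * cis (x / r)" for x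
    unfolding larmor_def centre(1)[symmetric] using rp by (simp add: algebra_simps)
  \<comment> \<open>On a circle the tangent turns by exactly 2 \<theta> between the two end points
    and \<xi> = 1; here \<xi> records the deviation.\<close>
  define \<xi> where "\<xi> = tangent (t - 2 * \<theta>) * cis (2 * \<theta>) / tangent t"
  have T0: "tangent t \<noteq> 0" using norm_tangent[of t] by auto
  have n\<xi>: "norm \<xi> = 1" by (simp add: \<xi>_def norm_mult norm_divide norm_tangent)
  define \<alpha> where "\<alpha> = Arg \<xi>"
  have cis\<alpha>: "cis \<alpha> = \<xi>" unfolding \<alpha>_def using n\<xi> cis_Arg[of \<xi>] by (cases "\<xi> = 0") (auto simp: sgn_eq)
  have \<alpha>_pi: "\<bar>\<alpha>\<bar> \<le> pi" unfolding \<alpha>_def using Arg_bounded[of \<xi>] by auto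
  have "norm (\<xi> - 1) \<le> 2 * d"
  proof -
    have "\<xi> - 1 = ((tangent (t - 2 * \<theta>) - \<i> * cis (t - 2 * \<theta>)) * cis (2 * \<theta>) - (tangent t - \<i> * cis t)) / tangent t"
      using T0 by (simp add: \<xi>_def field_simps cis_mult)
    also have "norm \<dots> \<le> norm (tangent (t - 2 * \<theta>) - \<i> * cis (t - 2 * \<theta>)) + norm (tangent t - \<i> * cis t)"
      unfolding norm_divide norm_tangent div_by_1
      by (rule order_trans[OF norm_triangle_ineq4]) (simp add: norm_mult)
    finally show ?thesis using tangent_near[of "t - 2 * \<theta>"] tangent_near[of t] by linarith
  qed
  moreover have "\<bar>\<alpha>\<bar> / 4 \<le> norm (\<xi> - 1)"
    using norm_cis_diff_ge[of \<alpha> 0] \<alpha>_pi by (simp add: cis\<alpha>)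
  ultimately have \<alpha>: "\<bar>\<alpha>\<bar> \<le> 8 * d" by linarith
  \<comment> \<open>The unperturbed velocity turns by 2 \<pi> - 2 \<delta> - 2 \<theta>, and
    \<alpha> corrects this for the true tangent. The factor r converts the angle into arc
    length.\<close>
  define x1 where "x1 = r * (2 * pi - 2 * \<delta> - 2 * \<theta> + \<alpha>)"
  have ang: "pi - \<theta> - \<delta> < x1 / r" "x1 / r < 2 * pi"
    using \<alpha> smallD(6,7) rp angles by (auto simp: x1_def abs_le_iff)
  have cis1: "v * cis (x1 / r) = v1"
  proof -
    have "cis (2 * pi - 2 * \<delta> - 2 * \<theta> + \<alpha>) = cis (- (2 * \<delta>)) * cis (- (2 * \<theta>)) * \<xi>"
      by (simp add: cis_mult cis\<alpha>[symmetric] complex_eq_iff cos_add sin_add cos_diff sin_diff)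
    then have "v * cis (x1 / r) = (cis \<delta> * cis (- (2 * \<delta>))) * (cis (- (2 * \<theta>)) * cis (2 * \<theta>)) * tangent (t - 2 * \<theta>)"
      using rp T0 by (simp add: x1_def v_def \<xi>_def)
    then show ?thesis by (simp only: cis_mult) (simp add: v1_def)
  qed
  have x1: "0 < x1"
  proof -
    have "0 < x1 / r" using ang angles by linarith
    then show ?thesis using rp by (simp add: zero_less_divide_iff)
  qed
  let ?A = "\<lambda>x. larmor (1 / r) (table t) v x"
  have avoid: "?A x \<notin> range table" if x: "x \<in> {0<..<x1}" for x
  proof
    have x': "0 < x / r" "x / r < x1 / r" using x rp by (auto simp: divide_strict_right_mono)
    assume "?A x \<in> range table"
    then obtain s where s: "?A x = table s" by blast
    obtain u and m :: int where um: "s - (t - \<theta>) = u + 2 * pi * m" "\<bar>u\<bar> \<le> pi" using reduce_mod_2pi by blast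
    then have "s = (t - \<theta> + u) + 2 * pi * m" by simp
    then have s': "?A x = table (t - \<theta> + u)" using s table_periodic_int by metis
    then have "table (t - \<theta> + u) - G (t - \<theta>) = - (\<i> * of_real r * v * cis (x / r))"
      using s'[symmetric] unfolding arc by simp
    then have "norm (table (t - \<theta> + u) - G (t - \<theta>)) = r"
      using n rp by (simp add: norm_mult)
    \<comment> \<open>The two points of the table on the Larmor circle are the start and the end of
      the arc. As the whole arc turns by less than 2 \<pi>, neither is passed in between.\<close>
    then have "u = \<theta> \<or> u = - \<theta>" using circle_meets_table um(2) by blast
    then show False
    proof
      assume "u = \<theta>"
      then have "v * cis (x / r) = v"
      proof -
        have "\<i> * of_real r * (v * cis (x / r)) = \<i> * of_real r * v"
        proof -
          have "G (t - \<theta>) - \<i> * of_real r * v * cis (x / r) = G (t - \<theta>) - \<i> * of_real r * v"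
            using s'[unfolded arc] \<open>u = \<theta>\<close> centre'(1) by simp
          then show ?thesis by (simp add: mult.assoc)
        qed
        then show ?thesis using rp by simp
      qed
      then have "cis (x / r) = 1" using v0 by simp
      then have "x / r = 0" by (rule cis_eq_1_imp) (use x' ang in linarith)
      then show False using x'(1) by linarith
    next
      assume u: "u = - \<theta>"
      have "t - \<theta> - \<theta> = t - 2 * \<theta>" by simp
      then have "?A x = table (t - 2 * \<theta>)" using s' u by simp
      then have "\<i> * of_real r * (v * cis (x / r)) = \<i> * of_real r * v1"
        unfolding arc centre'(2) by (simp add: mult.assoc)
      then have "v * cis (x / r) = v * cis (x1 / r)" using rp cis1 by simp
      then have "cis (x / r) = cis (x1 / r)" using v0 by simp
      then have "cis (x1 / r - x / r) = 1" by (simp add: cis_divide[symmetric])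
      then have "x1 / r - x / r = 0" by (rule cis_eq_1_imp) (use x' ang in linarith)
      then show False using x'(2) by linarith
    qed
  qed
  \<comment> \<open>Half of the unperturbed arc, where it crosses the line through the origin and
    the centre.\<close>
  define xm where "xm = r * (pi - \<theta> - \<delta>)"
  have xm: "xm \<in> {0<..<x1}"
  proof -
    have "r * (pi - \<theta> - \<delta>) < r * (x1 / r)" using ang(1) rp by (rule mult_strict_left_mono)
    then show ?thesis using rp angles by (simp add: xm_def)
  qed
  have "?A xm \<in> ball 0 (R - e)"
  proof -
    have c: "v * cis (pi - \<theta> - \<delta>) = - (tangent t * cis (- \<theta>))"
    proof -
      have "cis (pi - \<theta> - \<delta>) = - (cis (- \<theta>) * cis (- \<delta>))"
        by (simp add: cis_mult complex_eq_iff cos_diff sin_diff cos_add sin_add)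
      then have "v * cis (pi - \<theta> - \<delta>) = - (tangent t * cis (- \<theta>) * (cis \<delta> * cis (- \<delta>)))"
        by (simp add: v_def)
      then show ?thesis by (simp only: cis_mult) simp
    qed
    have "xm / r = pi - \<theta> - \<delta>" using rp by (simp add: xm_def)
    then have "?A xm = G (t - \<theta>) - \<i> * of_real r * (v * cis (pi - \<theta> - \<delta>))"
      by (simp only: arc mult.assoc)
    then have "?A xm = G (t - \<theta>) + \<i> * of_real r * (tangent t * cis (- \<theta>))" unfolding c by simp
    also have "\<dots> = (G (t - \<theta>) - cis (t - \<theta>)) + \<i> * of_real r * ((tangent t - \<i> * cis t) * cis (- \<theta>))
        + of_real (1 - r) * cis (t - \<theta>)"
    proof -
      have "cis t * cis (- \<theta>) = cis (t - \<theta>)" by (simp add: cis_mult)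
      then show ?thesis by (simp add: algebra_simps)
    qed
    also have "norm \<dots> \<le> \<epsilon> + r * d + \<bar>1 - r\<bar>"
    proof (intro norm_triangle_mono)
      show "norm (G (t - \<theta>) - cis (t - \<theta>)) \<le> \<epsilon>" by (rule near)
      show "norm (\<i> * of_real r * ((tangent t - \<i> * cis t) * cis (- \<theta>))) \<le> r * d"
        using tangent_near[of t] rp by (simp add: norm_mult)
      show "norm (of_real (1 - r) * cis (t - \<theta>)) \<le> \<bar>1 - r\<bar>"
        unfolding norm_mult norm_of_real by simp
    qed
    also have "\<dots> < R - e"
    proof -
      have "r \<le> sin \<theta> / sin \<delta> + e" "\<bar>1 - r\<bar> \<le> \<bar>1 - sin \<theta> / sin \<delta>\<bar> + e" using r_near by linarith+
      moreover have "r * d \<le> (sin \<theta> / sin \<delta> + e) * d" using calculation(1) pos by (intro mult_right_mono) auto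
      ultimately show ?thesis using smallD(8) by linarith
    qed
    finally show ?thesis by simp
  qed
  then have xm_in: "?A xm \<in> inside (path_image curve)" using ball_inside by blast
  have "?A ` {0<..<x1} \<subseteq> inside (path_image curve)"
  proof (rule connected_inside_curve[OF _ _ _ xm_in])
    have "continuous_on {0<..<x1} ?A" unfolding larmor_def by (intro continuous_intros)
    then show "connected (?A ` {0<..<x1})" by (rule connected_continuous_image) auto
    show "?A ` {0<..<x1} \<inter> range table = {}" using avoid by blast
    show "?A xm \<in> ?A ` {0<..<x1}" using xm by blast
  qed
  moreover have "table (t - 2 * \<theta>) = ?A x1"
    unfolding arc centre'(2) mult.assoc cis1 ..
  moreover have "v * cis (1 / r * x1) = v1" using cis1 by simp
  ultimately show ?thesis using that[OF x1] unfolding v_def v1_def by blast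
qed

lemma curve_gutkin: "magnetic_gutkin \<delta> (1 / r) curve"
  unfolding magnetic_gutkin_def
proof
  fix s
  obtain x1 where x1: "0 < x1"
    "\<And>x. x \<in> {0<..<x1} \<Longrightarrow> larmor (1 / r) (table (2 * pi * s)) (cis \<delta> * tangent (2 * pi * s)) x \<in> inside (path_image curve)"
    "table (2 * pi * s - 2 * \<theta>) = larmor (1 / r) (table (2 * pi * s)) (cis \<delta> * tangent (2 * pi * s)) x1"
    "cis \<delta> * tangent (2 * pi * s) * cis (1 / r * x1) = cis (- \<delta>) * tangent (2 * pi * s - 2 * \<theta>)"
    using larmor_arc by blast
  have s1: "2 * pi * (s - \<theta> / pi) = 2 * pi * s - 2 * \<theta>" by (simp add: field_simps)
  show "\<exists>t1>0. (\<forall>t\<in>{0<..<t1}. larmor (1 / r) (curve s) (cis \<delta> * unit_tangent curve s) t \<in> inside (path_image curve)) \<and>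
        (\<exists>s1. curve s1 = larmor (1 / r) (curve s) (cis \<delta> * unit_tangent curve s) t1 \<and>
              cis \<delta> * unit_tangent curve s * cis (1 / r * t1) = cis (- \<delta>) * unit_tangent curve s1)"
    using x1 by (intro exI[of _ x1] conjI ballI exI[of _ "s - \<theta> / pi"])
       (simp_all add: curve_unit_tangent curve_def s1)
qed

text \<open>On a circle about \<open>a\<close>, the vector \<open>table t - a\<close> is normal to
  the tangent, and its signed length is constant because it is continuous with at most two values.
  Then \<open>a\<close> is a fixed linear combination of \<open>G (t + \<theta>)\<close> and
  \<open>G (t - \<theta>)\<close>, which the hypothesis rules out.\<close>

lemma curve_not_sphere:
  assumes not_affine: "\<And>b1 b2 b3. (\<And>t. b1 * G (t + 2 * \<theta>) + b2 * G t = b3) \<Longrightarrow> b2 = 0"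
  shows "path_image curve \<noteq> sphere a \<rho>"
proof
  assume sphere: "path_image curve = sphere a \<rho>"
  have dist: "norm (table t - a) = \<rho>" for t
    using sphere path_image_curve by (auto simp: dist_norm norm_minus_commute)
  define h where "h t = Im ((table t - a) * cnj (tangent t))" for t
  have perp: "table t - a = \<i> * of_real (h t) * tangent t" for t
  proof -
    obtain l where l: "0 < l" "table' t = of_real l * tangent t" using table'_tangent by blast
    have "((\<lambda>t. table t - a) has_vector_derivative table' t - 0) (at t)"
      by (intro has_vector_derivative_diff table_deriv has_vector_derivative_const)
    then have TD: "((\<lambda>t. table t - a) has_vector_derivative table' t) (at t)" by simp
    have "((\<lambda>t. (table t - a) \<bullet> (table t - a)) has_real_derivative (table t - a) \<bullet> table' t + table' t \<bullet> (table t - a)) (at t)"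
      using bounded_bilinear.has_vector_derivative[OF bounded_bilinear_inner TD TD]
      by (simp add: has_real_derivative_iff_has_vector_derivative)
    moreover have "(\<lambda>t. (table t - a) \<bullet> (table t - a)) = (\<lambda>t. \<rho>\<^sup>2)"
      by (simp add: power2_norm_eq_inner[symmetric] dist)
    ultimately have "(table t - a) \<bullet> table' t + table' t \<bullet> (table t - a) = 0"
      using DERIV_unique[OF _ DERIV_const[of "\<rho>\<^sup>2"]] by metis
    then have "(table t - a) \<bullet> table' t = 0" by (simp add: inner_commute)
    then have "(table t - a) \<bullet> tangent t = 0" using l by (simp add: scaleR_conv_of_real[symmetric])
    then have "Re ((table t - a) * cnj (tangent t)) = 0" by (simp add: inner_complex_def)
    then have "(table t - a) * cnj (tangent t) = \<i> * of_real (h t)" by (simp add: h_def complex_eq_iff)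
    moreover have "cnj (tangent t) * tangent t = 1"
      using norm_tangent[of t] by (simp add: complex_norm_square[symmetric] mult.commute)
    ultimately show ?thesis by (metis mult.assoc mult.right_neutral)
  qed
  have "norm (table t - a) = \<bar>h t\<bar>" for t
    unfolding perp[of t] by (simp add: norm_mult norm_tangent)
  then have h_abs: "\<bar>h t\<bar> = \<rho>" for t using dist by simp
  have "continuous_on UNIV G"
    using G_deriv has_vector_derivative_continuous continuous_at_imp_continuous_on by blast
  then have contT: "continuous_on UNIV tangent"
    unfolding tangent_def[abs_def] using c_pos
    by (intro continuous_intros) (auto intro!: continuous_on_compose2[of UNIV G] continuous_intros)
  have "continuous_on UNIV table"
    using table_deriv has_vector_derivative_continuous continuous_at_imp_continuous_on by blast
  then have conth: "continuous_on UNIV h" unfolding h_def[abs_def] by (intro continuous_intros contT)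
  have "h constant_on UNIV"
  proof (rule continuous_finite_range_constant[OF connected_UNIV conth])
    have "range h \<subseteq> {\<rho>, - \<rho>}" using h_abs by (auto simp: abs_if split: if_splits) (metis minus_minus)+
    then show "finite (range h)" using finite_subset by blast
  qed
  then obtain q where q: "\<And>t. h t = q" by (auto simp: constant_on_def)
  let ?D = "2 * \<i> * of_real (sin \<delta>) :: complex"
  define b1 where "b1 = cis \<delta> / ?D - \<i> * of_real q / of_real c"
  define b2 where "b2 = - cis (- \<delta>) / ?D + \<i> * of_real q / of_real c"
  have "b1 * G (t + 2 * \<theta>) + b2 * G t = a" for t
  proof -
    have e1: "t + \<theta> + \<theta> = t + 2 * \<theta>" "t + \<theta> - \<theta> = t" by simp_all
    have "table (t + \<theta>) - \<i> * of_real q * tangent (t + \<theta>) = a"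
      using perp[of "t + \<theta>"] q by (simp add: algebra_simps)
    then show ?thesis
      unfolding table_def tangent_def b1_def b2_def e1
      by (simp add: diff_divide_distrib algebra_simps)
  qed
  then have "b2 = 0" by (rule not_affine)
  \<comment> \<open>The term with q is imaginary, so the real part comes from -cis (-\<delta>) / (2
    i sin \<delta>) alone.\<close>
  moreover have "Re b2 = 1 / 2" using sin_pos by (simp add: b2_def Re_divide power2_eq_square)
  ultimately show False by simp
qed

end

section \<open>Existence of non-circular tables\<close>

text \<open>The iterated real derivatives are restrictions of the complex ones, which exist to all
  orders.\<close>

lemma smooth_curve_holomorphic:
  assumes A: "open A" "\<And>t. of_real t \<in> A" and F: "F holomorphic_on A"
  shows "smooth_curve (\<lambda>t. F (of_real t))"
proof -
  have hol: "(deriv ^^ m) F holomorphic_on A" for m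
    by (rule holomorphic_higher_deriv[OF F A(1)])
  have D: "((\<lambda>t. (deriv ^^ m) F (of_real t)) has_vector_derivative (deriv ^^ Suc m) F (of_real t)) (at t)" for m t
    using has_vector_derivative_real_field[OF holomorphic_derivI[OF hol A(1) A(2)]] by simp
  have "(vd ^^ m) (\<lambda>t. F (of_real t)) = (\<lambda>t. (deriv ^^ m) F (of_real t))" for m
  proof (induction m)
    case (Suc m)
    have "(vd ^^ Suc m) (\<lambda>t. F (of_real t)) = vd (\<lambda>t. (deriv ^^ m) F (of_real t))"
      by (simp add: Suc)
    also have "\<dots> = (\<lambda>t. (deriv ^^ Suc m) F (of_real t))"
      unfolding vd_def by (rule ext) (rule vector_derivative_at[OF D])
    finally show ?case .
  qed simp
  then show ?thesis
    unfolding smooth_curve_def using D differentiableI_vector by metis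
qed

theorem theorem1p4:
  fixes \<delta> :: real
  assumes "0 < \<delta>" and "\<delta> < pi"
  shows "\<exists>g :: real \<Rightarrow> complex. \<exists>\<beta> :: real. \<beta> > 0 \<and>
           smooth_pos_jordan_curve g \<and>
           \<not> (\<exists>c r. path_image g = sphere c r) \<and>
           magnetic_gutkin \<delta> \<beta> g"
proof -
  note \<delta> = assms
  \<comment> \<open>This bound amounts to 3 \<pi> / (2 n) + \<delta> < \<pi>, which guarantees
    \<theta> + \<delta> < \<pi> for the half-angle found later.\<close>
  obtain n0 :: nat where n0: "3 * pi / (2 * (pi - \<delta>)) < real n0" using reals_Archimedean2 by blast
  define n where "n = max 4 n0"
  have n: "n \<ge> 4" "3 * pi / (2 * (pi - \<delta>)) < real n" using n0 by (auto simp: n_def)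
  then have np: "0 < real n" by simp
  have b: "3 * pi / (2 * n) + \<delta> < pi" using n(2) np \<delta> by (simp add: field_simps)
  obtain \<epsilon> where \<epsilon>: "\<epsilon> > 0" "\<And>\<theta>. pi / n \<le> \<theta> \<Longrightarrow> \<theta> \<le> 3 * pi / (2 * n) \<Longrightarrow> gutkin_small \<delta> \<theta> \<epsilon>"
    using gutkin_small_uniform[OF _ \<delta>(1) b, of "pi / n"] np by auto
  \<comment> \<open>The first bound serves the existence of h and u, the second brings the centre
    curve and its derivative within \<epsilon> of the unit circle.\<close>
  define p where "p = min (1 / (1000 * real n)) (\<epsilon> / (2000 * real n))"
  have p: "0 < p" "p \<le> 1 / (1000 * real n)" "2000 * real n * p \<le> \<epsilon>"
    using np \<epsilon>(1) by (auto simp: p_def min_def field_simps)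
  have p1: "p \<le> 1 / 4000" by (rule order_trans[OF p(2)]) (use n in \<open>simp add: field_simps\<close>)
  obtain h where h: "1 / 2 \<le> h" "h \<le> real n / (real n + 1)" "wegner_defect n p h = 0"
    using wegner_defect_zero[OF n(1) p(1,2)] by blast
  have "real n / (real n + 1) < 1" using np by simp
  then have "h < 1" using h(2) by linarith
  then interpret W: wegner_curve n p h
    using n p p1 h by unfold_locales auto
  have "108 * p\<^sup>2 < 1 / (real n + 1)"
  proof -
    have "p * p \<le> 1 / (1000 * real n) * (1 / 4000)" using p p1 by (intro mult_mono) auto
    moreover have "1 / (1000 * real n) * (1 / 4000) * 108 < 1 / (real n + 1)" using np n by (simp add: field_simps)
    ultimately show ?thesis by (simp add: power2_eq_square)
  qed
  then obtain u where u: "2 * pi / n < u" "u < 3 * pi / n" "Im (W.Y u) = 0" "exp (\<i> * of_real (real n * u)) \<noteq> 1"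
    using W.wegner_phase_zero[OF n(1) _ h(2)] by blast
  define \<theta> where "\<theta> = u / 2"
  have \<theta>: "pi / n < \<theta>" "\<theta> < 3 * pi / (2 * n)" using u by (simp_all add: \<theta>_def field_simps)
  have "0 < pi / n" using np by simp
  then have \<theta>0: "0 < \<theta>" using \<theta>(1) by linarith
  define G G' where "G t = W.\<Gamma> (of_real t)" and "G' t = deriv W.\<Gamma> (of_real t)" for t
  obtain c where c: "\<And>t. norm (G (t + u) - G t) = c"
    using W.wegner_chord_constant[OF u(4,3)] unfolding G_def by blast
  interpret N: near_circle G G' \<delta> \<theta> \<epsilon> "norm (deriv W.\<Gamma> 0)" c
  proof
    show "(G has_vector_derivative G' t) (at t)" for t
      unfolding G_def[abs_def] G'_def by (rule has_vector_derivative_real_field[OF W.wegner_has_derivative])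
    show "G (t + 2 * pi) = G t" for t
      using W.wegner_periodic[of "of_real t"] by (simp add: G_def)
    show "norm (G' t) = norm (deriv W.\<Gamma> 0)" for t
      unfolding G'_def by (rule W.wegner_speed_constant[OF h(3)])
    show "norm (G (t + \<theta>) - G (t - \<theta>)) = c" for t
    proof -
      have "t - \<theta> + u = t + \<theta>" by (simp add: \<theta>_def)
      then show ?thesis using c[of "t - \<theta>"] by (simp only:)
    qed
    show "norm (G t - cis t) \<le> \<epsilon>" "norm (G' t - \<i> * cis t) \<le> \<epsilon>" for t
      unfolding G_def G'_def by (rule W.wegner_near_circle[OF p1 p(3)])+
    show "gutkin_small \<delta> \<theta> \<epsilon>" using \<epsilon>(2) \<theta> by simp
  qed (use \<theta>0 \<theta> b \<delta> in auto)
  have "smooth_curve N.curve"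
  proof -
    let ?D = "2 * \<i> * of_real (sin \<delta>) :: complex"
    let ?f = "\<lambda>a s. 2 * of_real pi * s + of_real a :: complex"
    define A where "A = {s. ?f \<theta> s \<in> wegner_domain n p h \<and> ?f (- \<theta>) s \<in> wegner_domain n p h}"
    have cont: "continuous_on UNIV (?f a)" for a by (intro continuous_intros)
    have A_eq: "A = (?f \<theta> -` wegner_domain n p h) \<inter> (?f (- \<theta>) -` wegner_domain n p h)" by (auto simp: A_def)
    have "open A" unfolding A_eq by (intro open_Int open_vimage W.open_wegner_domain cont)
    moreover have "of_real t \<in> A" for t
      using W.of_real_wegner_domain[of "2 * pi * t + \<theta>"] W.of_real_wegner_domain[of "2 * pi * t + - \<theta>"]
      by (simp add: A_def)
    moreover have "(\<lambda>s. (cis \<delta> * W.\<Gamma> (?f \<theta> s) - cis (- \<delta>) * W.\<Gamma> (?f (- \<theta>) s)) / ?D) holomorphic_on A"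
    proof -
      have comp: "(\<lambda>s. W.\<Gamma> (?f a s)) holomorphic_on A" if "?f a ` A \<subseteq> wegner_domain n p h" for a
      proof -
        have "?f a holomorphic_on A" by (intro holomorphic_intros)
        from holomorphic_on_compose_gen[OF this W.holomorphic_wegner that] show ?thesis by (simp add: o_def)
      qed
      have "(\<lambda>s. W.\<Gamma> (?f \<theta> s)) holomorphic_on A" "(\<lambda>s. W.\<Gamma> (?f (- \<theta>) s)) holomorphic_on A"
        by (rule comp; auto simp: A_def)+
      then show ?thesis
        using N.sin_pos by (intro holomorphic_on_divide holomorphic_on_diff holomorphic_on_mult) auto
    qed
    ultimately have "smooth_curve (\<lambda>t. (cis \<delta> * W.\<Gamma> (?f \<theta> (of_real t)) - cis (- \<delta>) * W.\<Gamma> (?f (- \<theta>) (of_real t))) / ?D)"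
      by (rule smooth_curve_holomorphic)
    moreover have "(\<lambda>t. (cis \<delta> * W.\<Gamma> (?f \<theta> (of_real t)) - cis (- \<delta>) * W.\<Gamma> (?f (- \<theta>) (of_real t))) / ?D) = N.curve"
      by (rule ext) (simp add: N.curve_def N.table_def G_def)
    ultimately show ?thesis by simp
  qed
  then have "smooth_pos_jordan_curve N.curve"
    unfolding smooth_pos_jordan_curve_def
    using N.curve_periodic N.curve_inj N.curve_unit_tangent(1) N.winding_number_curve by blast
  moreover have "\<not> (\<exists>a \<rho>. path_image N.curve = sphere a \<rho>)"
  proof -
    have "b2 = 0" if b: "\<And>t. b1 * G (t + 2 * \<theta>) + b2 * G t = b3" for b1 b2 b3
    proof (rule W.wegner_chord_not_affine[OF u(4)])
      have "2 * \<theta> = u" by (simp add: \<theta>_def)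
      then show "b1 * W.\<Gamma> (of_real (t + u)) + b2 * W.\<Gamma> (of_real t) = b3" for t
        using b[of t] by (simp only: G_def)
    qed
    then show ?thesis using N.curve_not_sphere by blast
  qed
  moreover have "1 / N.r > 0" using N.r_pos by simp
  ultimately show ?thesis using N.curve_gutkin by blast
qed

end
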